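(* Let $p>3$ be a prime. Then $$\sum_{n=0}^{p-1}\frac{G_n^{(3)}}{(-27)^n}\equiv\begin{cases}2u\pmod p&\text{if }p=u^2+3v^2\equiv1\pmod3\text{ with }3\mid u-1,\\0\pmod p&\text{if }p\equiv2\pmod3,\end{cases}$$ $$\sum_{n=0}^{p-1}\frac{G_n^{(3)}}{3^n}\equiv\sum_{n=0}^{p-1}\frac{G_n^{(3)}}{243^n}\equiv\begin{cases}-L\pmod p&\text{if }3\mid p-1,\ 4p=L^2+27M^2\text{ and }3\mid L-1,\\0\pmod p&\text{if }p\equiv2\pmod3,\end{cases}$$ where $u,v,L,M$ are integers.
   Context: $G_n^{(3)}=\sum_{k=0}^n\binom nk(-1)^k\binom{2k}k\binom{3k}k27^{n-k}$. Congruences are in the ring of rationals with denominator prime to $p$. *)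

theory Defs
  imports "HOL-Number_Theory.Number_Theory"
begin

definition G3 :: "nat \<Rightarrow> int" where
  "G3 n = (\<Sum>k\<le>n. int (n choose k) * (- 1) ^ k * int ((2 * k) choose k)
                    * int ((3 * k) choose k) * 27 ^ (n - k))"

(* quotient_of yields the fraction in lowest terms with positive denominator. *)
definition p_integers :: "nat \<Rightarrow> rat set" where
  "p_integers p = {x. coprime (snd (quotient_of x)) (int p)}"

(* Congruence modulo the ideal generated by p in the ring p_integers p; both sides
   have to lie in the ring. *)
definition rat_cong :: "nat \<Rightarrow> rat \<Rightarrow> rat \<Rightarrow> bool" where
  "rat_cong p x y \<longleftrightarrow>
     x \<in> p_integers p \<and> y \<in> p_integers p \<and> (\<exists>z\<in>p_integers p. x - y = of_nat p * z)"

end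

theory Submission
  imports Defs "HOL-Computational_Algebra.Polynomial"
begin

text \<open>
  Write \<open>a k = (2k choose k) (3k choose k)\<close>. Exchanging summations shows that modulo \<open>p\<close> the sum
  over \<open>n < p\<close> of \<open>G n / m ^ n\<close> is the sum over \<open>k < p\<close> of \<open>a k / (27 - m) ^ k\<close>. This truncated
  hypergeometric sum is, up to a unit, the middle coefficient of
  \<open>((1 + x) (- m - 27 x)) ^ q\<close> with \<open>q = \<lfloor>p / 3\<rfloor>\<close>. For \<open>m = - 27\<close> the quadratic
  is \<open>27 (1 - x\<^sup>2)\<close>, and for \<open>m = 3\<close> and \<open>m = 243\<close> the two quadratics are proportional to reversals of
  each other. For \<open>m = 3\<close> the sum is also, up to a unit, the coefficient of \<open>y ^ (p - 1)\<close> in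
  \<open>(4 y\<^sup>3 + 24 (y + 1)\<^sup>2) ^ ((p - 1) / 2)\<close>, where \<open>4 y\<^sup>3 + 24 (y + 1)\<^sup>2 = 4 ((y + 2)\<^sup>3 - 2)\<close>.
  Hence for \<open>p = 6 r + 1\<close> the sums are congruent to \<open>(3r choose r)\<close> and \<open>16 ^ r (3r choose r)\<close>, and
  they vanish for \<open>p \<equiv> 2 (mod 3)\<close>.

  On the other hand \<open>- c ^ r (3r choose r)\<close> is congruent to the sum \<open>S c\<close> of the
  Legendre symbols of \<open>x\<^sup>3 + c\<close> (\<open>mordell_sum\<close>). The values \<open>\<chi>(c) S c\<close> depend only on the class of \<open>c\<close> modulo cubes; the
  three values have sum \<open>0\<close> and sum of squares \<open>6 p\<close>, so \<open>12 p - 3 (S c)\<^sup>2\<close> is a perfect square when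
  \<open>\<chi>(c) = 1\<close>. As \<open>S 1\<close> is even and \<open>S 16 \<equiv> - p - 1 (mod 9)\<close>, this gives
  \<open>p = (S 1 / 2)\<^sup>2 + 3 v\<^sup>2\<close> and \<open>4 p = (S 16)\<^sup>2 + 27 M\<^sup>2\<close>, and such representations are unique up
  to signs.
\<close>

subsection \<open>Reduction to truncated hypergeometric sums\<close>

lemma p_integersI:
  assumes "coprime d (int p)" "d \<noteq> 0" "x * of_int d = of_int a"
  shows "x \<in> p_integers p"
proof -
  obtain n e where q: "quotient_of x = (n, e)" by force
  have e: "e > 0" "coprime n e" "x = of_int n / of_int e"
    using quotient_of_denom_pos[OF q] quotient_of_coprime[OF q] quotient_of_div[OF q] by auto
  have "of_int (n * d) = (of_int (a * e) :: rat)"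
    using assms(3) e by (simp add: field_simps)
  then have "n * d = a * e" by linarith
  \<comment> \<open>The reduced denominator divides every denominator of \<open>x\<close>, so a
    single denominator prime to \<open>p\<close> suffices.\<close>
  then have "e dvd d"
    using e(2) by (metis coprime_commute coprime_dvd_mult_right_iff dvd_triv_right)
  then show ?thesis
    using assms(1) q by (auto simp: p_integers_def intro: coprime_divisors[of _ d _ "int p"])
qed

lemma p_integersE:
  assumes "x \<in> p_integers p"
  obtains a d where "coprime d (int p)" "d \<noteq> 0" "x * of_int d = of_int a"
proof -
  obtain n e where q: "quotient_of x = (n, e)" by force
  show ?thesis
    using that[of e n] assms q quotient_of_denom_pos[OF q] quotient_of_div[OF q]
    by (auto simp: p_integers_def)
qed

lemma p_integers_diff:
  assumes "x \<in> p_integers p" "y \<in> p_integers p"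
  shows "x - y \<in> p_integers p"
proof -
  obtain a d b e where "coprime d (int p)" "d \<noteq> 0" "x * of_int d = of_int a"
    "coprime e (int p)" "e \<noteq> 0" "y * of_int e = of_int b"
    using assms by (elim p_integersE)
  then show ?thesis
    by (intro p_integersI[of "d * e" p _ "a * e - b * d"]) (auto simp: algebra_simps)
qed

text \<open>The bridge to integer congruences: if \<open>d x = a\<close> and
  \<open>a - d b = p c\<close>, then \<open>x - b = p (c / d)\<close>, and \<open>c / d\<close> is
  integral at \<open>p\<close>.\<close>

lemma rat_cong_of_intI:
  assumes d: "coprime d (int p)" "d \<noteq> 0" and x: "x * of_int d = of_int a"
    and cong: "[a = d * b] (mod int p)"
  shows "rat_cong p x (of_int b)"
proof -
  obtain c where c: "a - d * b = int p * c"
    using cong by (auto simp: cong_iff_dvd_diff)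
  define z where "z = of_int c / (of_int d :: rat)"
  have "x - of_int b = (of_int (a - d * b) / of_int d :: rat)"
    using d(2) x by (simp add: field_simps)
  then have "x - of_int b = of_nat p * z"
    unfolding c z_def by simp
  moreover have "z \<in> p_integers p"
    by (rule p_integersI[OF d, of _ c]) (use d in \<open>simp add: z_def\<close>)
  moreover have "x \<in> p_integers p" "of_int b \<in> p_integers p"
    using p_integersI[OF d x] p_integersI[of 1 p "of_int b" b] by simp_all
  ultimately show ?thesis
    unfolding rat_cong_def by blast
qed

text \<open>Serves to compare the sums for 3 and 243 through one integer.\<close>

lemma rat_cong_common:
  assumes "rat_cong p x b" "rat_cong p y b"
  shows "rat_cong p x y"
proof -
  obtain z z' where "z \<in> p_integers p" "z' \<in> p_integers p"
    "x - b = of_nat p * z" "y - b = of_nat p * z'"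
    using assms unfolding rat_cong_def by blast
  moreover from this have "x - y = of_nat p * (z - z')"
    by (simp add: algebra_simps)
  ultimately show ?thesis
    using assms p_integers_diff unfolding rat_cong_def by blast
qed

section \<open>Binomial sums before reduction modulo a prime\<close>

text \<open>The sum over \<open>n\<close> of the coefficients \<open>n choose j\<close> is \<open>N choose (j + 1)\<close>, which for
  prime \<open>N\<close> vanishes modulo \<open>N\<close> unless \<open>j = N - 1\<close>.\<close>

lemma sum_binomial_homogeneous:
  fixes Y Z :: int
  assumes "k < N"
  shows "(\<Sum>n<N. int (n choose k) * (Y + Z) ^ (n - k) * Y ^ (N - 1 - n))
    = (\<Sum>j=k..<N. int (j choose k) * int (N choose Suc j) * Z ^ (j - k) * Y ^ (N - 1 - j))"
proof -
  \<comment> \<open>Expand in powers of \<open>Z\<close> and put \<open>j = i + k\<close>. By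
    trinomial revision \<open>(n choose k) (n - k choose i) = (n choose j) (j choose k)\<close>, so
    \<open>n\<close> survives only in \<open>n choose j\<close>.\<close>
  have inner: "int (n choose k) * (Y + Z) ^ (n - k) * Y ^ (N - 1 - n)
     = (\<Sum>j=k..<N. int (n choose j) * (int (j choose k) * Z ^ (j - k) * Y ^ (N - 1 - j)))"
    if n: "n < N" for n
  proof (cases "k \<le> n")
    case True
    have "int (n choose k) * (Y + Z) ^ (n - k) * Y ^ (N - 1 - n)
      = (\<Sum>i\<le>n - k. int (n choose k) * (int (n - k choose i) * Z ^ i * Y ^ (n - k - i) * Y ^ (N - 1 - n)))"
      by (subst add.commute, subst binomial_ring) (simp add: sum_distrib_left sum_distrib_right mult_ac)
    also have "\<dots> = (\<Sum>j=k..n. int (n choose j) * (int (j choose k) * Z ^ (j - k) * Y ^ (N - 1 - j)))"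
    proof (rule sum.reindex_bij_witness[of _ "\<lambda>j. j - k" "\<lambda>i. i + k"], goal_cases)
      case (5 i)
      have 1: "int (n choose k) * int (n - k choose i) = int (n choose (i + k)) * int (i + k choose k)"
        using choose_mult[of k "i + k" n] 5 True by (simp flip: of_nat_mult)
      have 2: "Y ^ (n - k - i) * Y ^ (N - 1 - n) = Y ^ (N - 1 - (i + k))"
        using 5 True n by (simp add: add.commute flip: power_add)
      show ?case using arg_cong2[OF 1 2, of "\<lambda>a b. a * b * Z ^ i", symmetric]
        by (simp only: add_diff_cancel_right' mult_ac)
    qed (use True in auto)
    also have "\<dots> = (\<Sum>j=k..<N. int (n choose j) * (int (j choose k) * Z ^ (j - k) * Y ^ (N - 1 - j)))"
      by (rule sum.mono_neutral_left) (use n in auto)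
    finally show ?thesis .
  next
    case False
    then show ?thesis
      by (auto simp: binomial_eq_0 intro!: sum.neutral[symmetric])
  qed
  have upper: "(\<Sum>n<N. n choose j) = (N choose Suc j)" for j
    using sum_choose_upper[of j "N - 1"] assms by (cases N) (auto simp: lessThan_Suc_atMost)
  have "(\<Sum>n<N. int (n choose k) * (Y + Z) ^ (n - k) * Y ^ (N - 1 - n))
    = (\<Sum>n<N. \<Sum>j=k..<N. int (n choose j) * (int (j choose k) * Z ^ (j - k) * Y ^ (N - 1 - j)))"
    using inner by simp
  also have "\<dots> = (\<Sum>j=k..<N. int (\<Sum>n<N. n choose j) * (int (j choose k) * Z ^ (j - k) * Y ^ (N - 1 - j)))"
    by (subst sum.swap) (simp add: sum_distrib_right)
  finally show ?thesis
    unfolding upper by (simp add: mult_ac)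
qed

lemma Suc_times_binomial_Suc_int:
  "int (Suc l) * int (N choose Suc l) = (int N - int l) * int (N choose l)"
proof (cases "l \<le> N")
  case True
  then show ?thesis
    using binomial_absorb_comp[of N l] binomial_absorption[of l N]
    by (metis of_nat_diff of_nat_mult)
qed (simp add: binomial_eq_0)

lemma Suc_times_binomial_add_Suc_int:
  "int (Suc l) * int (n + Suc l choose Suc l) = int (n + Suc l) * int (n + l choose l)"
  using binomial_absorption[of l "n + Suc l"] by (simp only: flip: of_nat_mult) simp

text \<open>This is the multinomial coefficient \<open>(3 k)! / k!^3\<close>.\<close>

definition a3 :: "nat \<Rightarrow> int" where
  "a3 k = int ((2 * k) choose k) * int ((3 * k) choose k)"

section \<open>Binomial coefficients modulo a prime\<close>

locale prime_gt_3 =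
  fixes p :: nat
  assumes prime_p: "prime p" and p_gt_3: "p > 3"
begin

lemma prime_int_p: "prime (int p)"
  using prime_p by simp

lemma odd_p: "odd p"
  using prime_p p_gt_3 prime_odd_nat by auto

lemma fermat_int:
  assumes "\<not> int p dvd a"
  shows "[a ^ (p - 1) = 1] (mod int p)"
proof -
  have a: "int (nat (a mod int p)) = a mod int p" using p_gt_3 by simp
  have "\<not> p dvd nat (a mod int p)"
    using assms a by (metis dvd_mod_iff dvd_refl int_dvd_int_iff)
  from fermat_theorem[OF prime_p this]
  have "[int (nat (a mod int p) ^ (p - 1)) = int 1] (mod int p)"
    by (simp only: cong_int_iff)
  then show ?thesis
    unfolding of_nat_power a by (simp add: cong_def power_mod)
qed

lemma not_dvd_small: "\<not> int p dvd a" if "0 < a" "a < int p"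
  using that zdvd_not_zless by blast

lemma coprime_int_p_iff: "coprime a (int p) \<longleftrightarrow> \<not> int p dvd a"
  using prime_int_p
  by (metis coprime_commute not_coprimeI not_prime_unit prime_imp_coprime dvd_refl)

lemma cong_mult_cancel:
  assumes "\<not> int p dvd c" "[c * a = c * b] (mod int p)"
  shows "[a = b] (mod int p)"
  using assms cong_mult_lcancel coprime_int_p_iff by blast

text \<open>Modulo \<open>p\<close> the upper entry is \<open>- (n + 1)\<close>, so this is upper
  negation. The induction compares consecutive ratios; \<open>l + 1\<close> can be cancelled because
  it is below \<open>p\<close>.\<close>

lemma cong_binomial_neg:
  assumes "l < p" "n < p"
  shows "[int (p - 1 - n choose l) = (- 1) ^ l * int (n + l choose l)] (mod int p)"
  using assms
proof (induction l)
  case 0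
  then show ?case by simp
next
  case (Suc l)
  have 1: "int (Suc l) * int (p - 1 - n choose Suc l)
      = (int (p - 1 - n) - int l) * int (p - 1 - n choose l)"
    by (rule Suc_times_binomial_Suc_int)
  have 2: "int (Suc l) * int (n + Suc l choose Suc l) = int (n + Suc l) * int (n + l choose l)"
    by (rule Suc_times_binomial_add_Suc_int)
  have 3: "[int (p - 1 - n) - int l = - int (n + Suc l)] (mod int p)"
    using Suc.prems by (simp add: cong_iff_dvd_diff of_nat_diff)
  have "[int (Suc l) * int (p - 1 - n choose Suc l)
      = - int (n + Suc l) * ((- 1) ^ l * int (n + l choose l))] (mod int p)"
    unfolding 1 by (intro cong_mult 3 Suc.IH) (use Suc.prems in auto)
  also have "- int (n + Suc l) * ((- 1) ^ l * int (n + l choose l))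
    = int (Suc l) * ((- 1) ^ Suc l * int (n + Suc l choose Suc l))"
    using arg_cong[OF 2, of "\<lambda>t. (- 1) ^ Suc l * t"] by (simp add: algebra_simps)
  finally show ?case
    by (rule cong_mult_cancel[rotated]) (use Suc.prems not_dvd_small in force)
qed

text \<open>Take \<open>Z = X - Y\<close> in the homogeneous identity. Only \<open>j = p - 1\<close>
  survives modulo \<open>p\<close>, and \<open>p - 1 choose k\<close> is \<open>(- 1) ^ k\<close> by
  upper negation.\<close>

lemma cong_sum_binomial_homogeneous:
  fixes X Y :: int
  assumes "k < p"
  shows "[(\<Sum>n<p. int (n choose k) * X ^ (n - k) * Y ^ (p - 1 - n))
    = (- 1) ^ k * (X - Y) ^ (p - 1 - k)] (mod int p)"
proof -
  let ?f = "\<lambda>j. int (j choose k) * int (p choose Suc j) * (X - Y) ^ (j - k) * Y ^ (p - 1 - j)"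
  have terms: "[?f j = (if j = p - 1 then ?f j else 0)] (mod int p)" if "j \<in> {k..<p}" for j
  proof -
    have "int p dvd int (p choose Suc j)" if "j \<noteq> p - 1"
      using dvd_choose_prime[of "Suc j" p] prime_p \<open>j \<in> {k..<p}\<close> that by auto
    then show ?thesis
      by (simp add: cong_0_iff)
  qed
  have "(\<Sum>n<p. int (n choose k) * X ^ (n - k) * Y ^ (p - 1 - n)) = (\<Sum>j=k..<p. ?f j)"
    using sum_binomial_homogeneous[OF assms, of Y "X - Y"] by simp
  \<comment> \<open>The form \<open>p - 1 - 0\<close> matches \<open>cong_binomial_neg\<close> at
    \<open>n = 0\<close>.\<close>
  moreover have "(\<Sum>j=k..<p. if j = p - 1 then ?f j else 0)
      = int (p - 1 - 0 choose k) * (X - Y) ^ (p - 1 - k)"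
    using assms by (subst sum.delta) auto
  moreover have "[(\<Sum>j=k..<p. ?f j) = (\<Sum>j=k..<p. if j = p - 1 then ?f j else 0)] (mod int p)"
    by (intro cong_sum terms)
  ultimately have "[(\<Sum>n<p. int (n choose k) * X ^ (n - k) * Y ^ (p - 1 - n))
      = int (p - 1 - 0 choose k) * (X - Y) ^ (p - 1 - k)] (mod int p)"
    by (simp only:)
  moreover have "[int (p - 1 - 0 choose k) * (X - Y) ^ (p - 1 - k)
      = (- 1) ^ k * int (0 + k choose k) * (X - Y) ^ (p - 1 - k)] (mod int p)"
    by (intro cong_mult cong_binomial_neg cong_refl) (use assms in auto)
  ultimately show ?thesis
    using cong_trans by fastforce
qed

text \<open>The rational sum multiplied by \<open>m ^ (p - 1)\<close>. This factor is 1 modulo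
  \<open>p\<close> for \<open>m\<close> prime to \<open>p\<close>, so clearing denominators keeps
  the residue.\<close>

definition G_sum :: "int \<Rightarrow> int" where
  "G_sum m = (\<Sum>n<p. G3 n * m ^ (p - 1 - n))"

lemma rat_cong_G_sum:
  assumes "\<not> int p dvd m" "[G_sum m = b] (mod int p)"
  shows "rat_cong p (\<Sum>n = 0..p - 1. of_int (G3 n) / of_int m ^ n) (of_int b)"
proof (rule rat_cong_of_intI[of "m ^ (p - 1)"])
  show "coprime (m ^ (p - 1)) (int p)" "m ^ (p - 1) \<noteq> 0"
    using assms(1) prime_dvd_power[OF prime_int_p] by (auto simp: coprime_int_p_iff)
  have "{0..p - 1} = {..<p}" using p_gt_3 by auto
  then have "(\<Sum>n = 0..p - 1. of_int (G3 n) / of_int m ^ n) * of_int (m ^ (p - 1))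
    = (\<Sum>n<p. of_int (G3 n) / of_int m ^ n * of_int (m ^ (p - 1)) :: rat)"
    by (simp add: sum_distrib_right)
  also have "\<dots> = (\<Sum>n<p. of_int (G3 n * m ^ (p - 1 - n)))"
  proof (intro sum.cong refl)
    fix n assume "n \<in> {..<p}"
    then have "m ^ (p - 1) = m ^ n * m ^ (p - 1 - n)" by (simp flip: power_add)
    then show "of_int (G3 n) / of_int m ^ n * of_int (m ^ (p - 1)) = (of_int (G3 n * m ^ (p - 1 - n)) :: rat)"
      using assms(1) by (auto simp: field_simps)
  qed
  finally show "(\<Sum>n = 0..p - 1. of_int (G3 n) / of_int m ^ n) * of_int (m ^ (p - 1))
    = (of_int (G_sum m) :: rat)"
    by (simp add: G_sum_def)
  show "[G_sum m = m ^ (p - 1) * b] (mod int p)"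
    using assms(2) cong_mult[OF fermat_int[OF assms(1)] cong_refl[of b]]
    by (metis cong_sym cong_trans mult_1)
qed

text \<open>After exchanging summations the inner sum contributes a sign \<open>(- 1) ^ k\<close>,
  which cancels the one in \<open>G3\<close>.\<close>

lemma cong_G_sum: "[G_sum m = (\<Sum>k<p. a3 k * (27 - m) ^ (p - 1 - k))] (mod int p)"
proof -
  \<comment> \<open>Terms with \<open>k > n\<close> vanish, so the range of \<open>k\<close> can be
    made independent of \<open>n\<close>.\<close>
  have G: "G3 n = (\<Sum>k<p. int (n choose k) * (- 1) ^ k * a3 k * 27 ^ (n - k))" if "n < p" for n
    unfolding G3_def a3_def mult.assoc
    by (rule sum.mono_neutral_left) (use that in auto)
  have "G_sum m = (\<Sum>n<p. \<Sum>k<p. (- 1) ^ k * a3 k * (int (n choose k) * 27 ^ (n - k) * m ^ (p - 1 - n)))"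
    unfolding G_sum_def by (auto simp: G sum_distrib_left sum_distrib_right mult_ac intro!: sum.cong)
  also have "\<dots> = (\<Sum>k<p. (- 1) ^ k * a3 k * (\<Sum>n<p. int (n choose k) * 27 ^ (n - k) * m ^ (p - 1 - n)))"
    by (subst sum.swap) (simp add: sum_distrib_left)
  also have "[\<dots> = (\<Sum>k<p. (- 1) ^ k * a3 k * ((- 1) ^ k * (27 - m) ^ (p - 1 - k)))] (mod int p)"
    by (intro cong_sum cong_mult cong_refl cong_sum_binomial_homogeneous) auto
  also have "(\<Sum>k<p. (- 1) ^ k * a3 k * ((- 1) ^ k * (27 - m) ^ (p - 1 - k)))
    = (\<Sum>k<p. a3 k * (27 - m) ^ (p - 1 - k))"
    by (intro sum.cong refl) (simp add: mult_ac flip: power_mult_distrib)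
  finally show ?thesis .
qed

end

subsection \<open>Middle coefficients of powers of quadratics\<close>

lemma Suc_times_central_binomial:
  "int (Suc l) * int (2 * Suc l choose Suc l) = 2 * (2 * int l + 1) * int (2 * l choose l)"
proof -
  have "int (Suc l) * int (2 * Suc l choose Suc l) = int (2 * Suc l) * int (Suc (2 * l) choose l)"
    using binomial_absorption[of l "2 * Suc l"] by (simp only: flip: of_nat_mult) simp
  moreover have "int (Suc l) * int (Suc (2 * l) choose l) = (2 * int l + 1) * int (2 * l choose l)"
  proof -
    have "Suc (2 * l) - l = Suc l" by simp
    then have "Suc l * (Suc (2 * l) choose l) = Suc (2 * l) * (2 * l choose l)"
      using binomial_absorb_comp[of "Suc (2 * l)" l] by simp
    then have "int (Suc l * (Suc (2 * l) choose l)) = int (Suc (2 * l) * (2 * l choose l))"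
      by (simp only:)
    then show ?thesis
      unfolding of_nat_mult by simp
  qed
  ultimately have "int (Suc l) * (int (Suc l) * int (2 * Suc l choose Suc l))
     = int (Suc l) * (2 * (2 * int l + 1) * int (2 * l choose l))"
    by (simp add: algebra_simps)
  then show ?thesis
    by (simp only: mult_cancel_left) simp
qed

text \<open>Comparison of \<open>a3 j * j!^3 = (3 j)!\<close> at \<open>j = k\<close> and
  \<open>j = k + 1\<close>.\<close>

lemma a3_Suc:
  "int (Suc k) ^ 2 * a3 (Suc k) = 3 * (3 * int k + 1) * (3 * int k + 2) * a3 k"
proof -
  have fact: "a3 j * fact j ^ 3 = fact (3 * j)" for j
  proof -
    have "fact j * fact (2 * j) * (3 * j choose j) = fact (3 * j)"
      using binomial_fact_lemma[of j "3 * j"] by simp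
    moreover have "fact j * fact j * (2 * j choose j) = fact (2 * j)"
      using binomial_fact_lemma[of j "2 * j"] by (simp add: mult_2)
    ultimately have "fact j * (fact j * fact j * (2 * j choose j)) * (3 * j choose j) = fact (3 * j)"
      by (simp only:)
    then have "(2 * j choose j) * (3 * j choose j) * fact j ^ 3 = fact (3 * j)"
      by (simp only: power3_eq_cube mult_ac)
    then have "int ((2 * j choose j) * (3 * j choose j) * fact j ^ 3) = int (fact (3 * j))"
      by simp
    then show ?thesis
      by (simp add: a3_def)
  qed
  have "fact (3 * Suc k) = (fact (Suc (Suc (Suc (3 * k)))) :: int)"
    by (rule arg_cong[of _ _ fact]) simp
  also have "\<dots> = (3 * int k + 1) * (3 * int k + 2) * (3 * int k + 3) * fact (3 * k)"
    unfolding fact_Suc by (simp add: algebra_simps)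
  finally have "a3 (Suc k) * fact (Suc k) ^ 3
      = (3 * int k + 1) * (3 * int k + 2) * (3 * int k + 3) * (fact (3 * k) :: int)"
    unfolding fact .
  also have "\<dots> = (3 * int k + 1) * (3 * int k + 2) * (3 * int k + 3) * (a3 k * fact k ^ 3)"
    by (simp add: fact)
  finally have "(int (Suc k) * fact k ^ 3) * (int (Suc k) ^ 2 * a3 (Suc k))
     = (int (Suc k) * fact k ^ 3) * (3 * (3 * int k + 1) * (3 * int k + 2) * a3 k)"
    by (simp add: algebra_simps power2_eq_square power3_eq_cube)
  then show ?thesis
    by (subst (asm) mult_cancel_left) simp
qed

lemma coeff_one_plus_X_power:
  "Polynomial.coeff ([:1, 1:] ^ n :: int poly) k = int (n choose k)"
  by (cases "k \<le> n") (simp_all add: coeff_linear_poly_power binomial_eq_0 coeff_eq_0 degree_linear_power)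

text \<open>The second factor is \<open>w + c (1 + x)\<close>. Expanding its power leaves multiples
  of \<open>(1 + x) ^ (q + k)\<close>, whose coefficient at \<open>q\<close> is
  \<open>q + k choose q\<close>.\<close>

lemma sum_binomial_eq_coeff:
  fixes c w :: int
  shows "(\<Sum>k\<le>q. int (q choose k) * int (q + k choose k) * c ^ k * w ^ (q - k))
    = Polynomial.coeff (([:1, 1:] * [:w + c, c:]) ^ q) q"
proof -
  have "[:w + c, c:] = Polynomial.smult c [:1, 1:] + [:w:]"
    by simp
  then have "[:w + c, c:] ^ q = (\<Sum>k\<le>q. Polynomial.smult (int (q choose k) * c ^ k * w ^ (q - k)) ([:1, 1:] ^ k))"
    by (simp only: binomial_ring)
       (simp add: smult_power poly_const_pow of_nat_poly mult_ac del: smult_pCons)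
  then have "([:1, 1:] * [:w + c, c:]) ^ q
    = (\<Sum>k\<le>q. Polynomial.smult (int (q choose k) * c ^ k * w ^ (q - k)) ([:1, 1:] ^ (q + k)))"
    by (simp only: power_mult_distrib sum_distrib_left power_add mult_smult_right)
  then have "Polynomial.coeff (([:1, 1:] * [:w + c, c:]) ^ q) q
     = (\<Sum>k\<le>q. int (q choose k) * c ^ k * w ^ (q - k) * int (q + k choose q))"
    by (simp only: coeff_sum coeff_smult coeff_one_plus_X_power)
  then show ?thesis
    using binomial_symmetric[of q "q + _"] by (simp add: mult_ac)
qed

text \<open>Since \<open>f ^ q\<close> has degree \<open>2 q\<close>, reversal fixes the coefficient
  at \<open>q\<close>.\<close>

lemma coeff_power_reflect:
  fixes f :: "int poly"
  assumes "Polynomial.degree f = 2" "Polynomial.coeff f 0 \<noteq> 0"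
  shows "Polynomial.coeff (reflect_poly f ^ q) q = Polynomial.coeff (f ^ q) q"
proof -
  have "Polynomial.degree (f ^ q) = 2 * q"
    using assms by (subst degree_power_eq) auto
  then show ?thesis
    by (simp add: coeff_reflect_poly flip: reflect_poly_power)
qed

lemma coeff_one_minus_square_power:
  "Polynomial.coeff ([:1, 0, -1 :: int:] ^ q) q
    = (if even q then (- 1) ^ (q div 2) * int (q choose (q div 2)) else 0)"
proof -
  have "[:1, 0, -1 :: int:] = Polynomial.monom (-1) 2 + 1"
    by (simp add: numeral_2_eq_2 monom_Suc monom_0 one_pCons)
  then have "[:1, 0, -1 :: int:] ^ q
      = (\<Sum>k\<le>q. Polynomial.monom ((- 1) ^ k * int (q choose k)) (2 * k))"
    by (simp only: binomial_ring) (simp add: monom_power of_nat_poly mult_ac smult_monom)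
  then have "Polynomial.coeff ([:1, 0, -1 :: int:] ^ q) q
      = (\<Sum>k\<le>q. if 2 * k = q then (- 1) ^ k * int (q choose k) else 0)"
    by (simp add: coeff_sum)
  also have "\<dots> = (if even q then (- 1) ^ (q div 2) * int (q choose (q div 2)) else 0)"
  proof (cases "even q")
    case True
    then have "(\<Sum>k\<le>q. if 2 * k = q then (- 1) ^ k * int (q choose k) else 0)
        = (\<Sum>k\<le>q. if k = q div 2 then (- 1) ^ k * int (q choose k) else 0)"
      by (intro sum.cong) auto
    then show ?thesis using True by (simp add: sum.delta)
  qed (auto intro!: sum.neutral)
  finally show ?thesis .
qed

context prime_gt_3
begin

text \<open>Modulo \<open>p\<close> the number \<open>(p - 1) / 2\<close> is \<open>- 1 / 2\<close>,
  and \<open>(2 l choose l)\<close> is \<open>(- 4) ^ l\<close> times the binomial coefficient of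
  \<open>- 1 / 2\<close> over \<open>l\<close>.\<close>

lemma cong_central_binomial:
  assumes "l < p"
  shows "[int (2 * l choose l) = (- 4) ^ l * int ((p - 1) div 2 choose l)] (mod int p)"
  using assms
proof (induction l)
  case (Suc l)
  define h where "h = (p - 1) div 2"
  have h: "int p = 2 * int h + 1"
    using odd_p unfolding h_def by presburger
  have "2 * (2 * int l + 1) - (- 4 * (int h - int l)) = int p * 2"
    using h by simp
  then have 1: "[2 * (2 * int l + 1) = - 4 * (int h - int l)] (mod int p)"
    by (simp only: cong_iff_dvd_diff dvd_triv_left)
  have "[int (2 * l choose l) = (- 4) ^ l * int (h choose l)] (mod int p)"
    using Suc unfolding h_def by simp
  from cong_mult[OF 1 this]
  have "[int (Suc l) * int (2 * Suc l choose Suc l)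
      = - 4 * (int h - int l) * ((- 4) ^ l * int (h choose l))] (mod int p)"
    unfolding Suc_times_central_binomial .
  also have "- 4 * (int h - int l) * ((- 4) ^ l * int (h choose l))
      = int (Suc l) * ((- 4) ^ Suc l * int (h choose Suc l))"
    by (subst (2) mult.left_commute, subst Suc_times_binomial_Suc_int) (simp only: power_Suc mult_ac)
  finally show ?case
    unfolding h_def by (rule cong_mult_cancel[rotated]) (use Suc.prems not_dvd_small in force)
qed simp

text \<open>With \<open>q = p div 3\<close>, modulo \<open>p\<close> either \<open>q\<close> is
  \<open>- 1 / 3\<close> or \<open>q\<close> is \<open>- 2 / 3\<close>. In both cases
  \<open>q (q + 1)\<close> is \<open>- 2 / 9\<close>, so both sides have the same ratio of
  consecutive terms.\<close>

lemma cong_a3_third: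
  assumes "k < p"
  shows "[a3 k = int (p div 3 choose k) * int (p div 3 + k choose k) * (- 27) ^ k] (mod int p)"
  using assms
proof (induction k)
  case 0
  then show ?case by (simp add: a3_def)
next
  case (Suc k)
  define q where "q = p div 3"
  have "\<not> 3 dvd p"
    using primes_dvd_imp_eq[of 3 p] prime_p p_gt_3 by auto
  then have "p = 3 * q + 1 \<or> p = 3 * q + 2"
    unfolding q_def by presburger
  \<comment> \<open>The left side equals \<open>(3 q + 1) (3 q + 2)\<close>, and \<open>p\<close> is
    one of these factors.\<close>
  then have "(3 * int k + 1) * (3 * int k + 2) - (- 9) * ((int q - int k) * (int q + int k + 1))
     = int p * int (3 * q + (if p = 3 * q + 1 then 2 else 1))"
    by (auto simp: algebra_simps)
  then have 1: "[(3 * int k + 1) * (3 * int k + 2) = (- 9) * ((int q - int k) * (int q + int k + 1))] (mod int p)"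
    unfolding cong_iff_dvd_diff by simp
  have "int (Suc k) ^ 2 * a3 (Suc k) = 3 * ((3 * int k + 1) * (3 * int k + 2)) * a3 k"
    using a3_Suc by simp
  also have "[\<dots> = 3 * ((- 9) * ((int q - int k) * (int q + int k + 1)))
      * (int (q choose k) * int (q + k choose k) * (- 27) ^ k)] (mod int p)"
    by (rule cong_mult[OF cong_mult[OF cong_refl 1]]) (use Suc in \<open>simp add: q_def\<close>)
  also have "3 * ((- 9) * ((int q - int k) * (int q + int k + 1))) * (int (q choose k) * int (q + k choose k) * (- 27) ^ k)
     = ((int q - int k) * int (q choose k)) * (int (q + Suc k) * int (q + k choose k)) * (- 27) ^ Suc k"
    by (simp add: algebra_simps)
  also have "\<dots> = int (Suc k) ^ 2 * (int (q choose Suc k) * int (q + Suc k choose Suc k) * (- 27) ^ Suc k)"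
    unfolding Suc_times_binomial_Suc_int[symmetric] Suc_times_binomial_add_Suc_int[symmetric]
    by (simp only: power2_eq_square mult_ac)
  finally show ?case
    unfolding q_def
    by (rule cong_mult_cancel[rotated]) (use Suc.prems not_dvd_small prime_dvd_power[OF prime_int_p] in force)
qed

text \<open>The terms with \<open>k > p div 3\<close> drop out, a common power of
  \<open>w = 27 - m\<close> is extracted, and \<open>c = - 27\<close> gives
  \<open>w + c = - m\<close>.\<close>

lemma cong_G_sum_coeff:
  "[G_sum m = (27 - m) ^ (p - 1 - p div 3)
     * Polynomial.coeff (([:1, 1:] * [:- m, -27:]) ^ (p div 3)) (p div 3)] (mod int p)"
proof -
  define q w where "q = p div 3" and "w = 27 - m"
  have q: "q < p" using p_gt_3 unfolding q_def by simp
  have "[G_sum m = (\<Sum>k<p. int (q choose k) * int (q + k choose k) * (- 27) ^ k * w ^ (p - 1 - k))] (mod int p)"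
    unfolding q_def w_def
    by (rule cong_trans[OF cong_G_sum]) (intro cong_sum cong_mult cong_a3_third cong_refl; simp)
  also have "(\<Sum>k<p. int (q choose k) * int (q + k choose k) * (- 27) ^ k * w ^ (p - 1 - k))
    = (\<Sum>k\<le>q. int (q choose k) * int (q + k choose k) * (- 27) ^ k * w ^ (p - 1 - k))"
    by (rule sum.mono_neutral_right) (use q in auto)
  also have "\<dots> = (\<Sum>k\<le>q. w ^ (p - 1 - q) * (int (q choose k) * int (q + k choose k) * (- 27) ^ k * w ^ (q - k)))"
  proof (intro sum.cong refl)
    fix k assume "k \<in> {..q}"
    then have "w ^ (p - 1 - k) = w ^ (p - 1 - q) * w ^ (q - k)"
      using q by (simp flip: power_add)
    then show "int (q choose k) * int (q + k choose k) * (- 27) ^ k * w ^ (p - 1 - k)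
      = w ^ (p - 1 - q) * (int (q choose k) * int (q + k choose k) * (- 27) ^ k * w ^ (q - k))"
      by simp
  qed
  also have "\<dots> = w ^ (p - 1 - q) * Polynomial.coeff (([:1, 1:] * [:- m, -27:]) ^ q) q"
    using sum_binomial_eq_coeff[of q "-27" w] by (simp add: w_def flip: sum_distrib_left)
  finally show ?thesis
    unfolding q_def w_def .
qed

end

subsection \<open>Coefficients of powers of cubics\<close>

text \<open>The \<open>l\<close>-th term of the binomial expansion needs the coefficient of
  \<open>(1 + y) ^ (2 (h - l))\<close> at \<open>2 h - 3 l\<close>, which by symmetry is the one at
  \<open>l\<close>. If \<open>3 l > 2 h\<close>, both are zero.\<close>

lemma coeff_cubic_power:
  fixes w :: int
  shows "Polynomial.coeff ((Polynomial.monom 4 3 + Polynomial.smult w ([:1, 1:] ^ 2)) ^ h) (2 * h)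
    = (\<Sum>l\<le>h. int (h choose l) * 4 ^ l * int (2 * h - 2 * l choose l) * w ^ (h - l))"
proof -
  have "Polynomial.coeff (of_nat (h choose l) * Polynomial.monom 4 3 ^ l
      * Polynomial.smult w ([:1, 1:] ^ 2) ^ (h - l)) (2 * h)
    = int (h choose l) * 4 ^ l * int (2 * h - 2 * l choose l) * w ^ (h - l)" if "l \<le> h" for l
  proof -
    have "of_nat (h choose l) * Polynomial.monom 4 3 ^ l * Polynomial.smult w ([:1, 1:] ^ 2) ^ (h - l)
      = Polynomial.monom (int (h choose l) * 4 ^ l) (3 * l)
        * Polynomial.smult (w ^ (h - l)) ([:1, 1:] ^ (2 * (h - l)))"
      by (simp only: smult_power power_mult of_nat_poly monom_power)
        (simp add: smult_monom mult_ac)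
    moreover have "int (2 * (h - l) choose (2 * h - 3 * l)) = int (2 * h - 2 * l choose l)"
      if "3 * l \<le> 2 * h"
      using that binomial_symmetric[of l "2 * h - 2 * l"]
      by (simp add: diff_mult_distrib2)
    moreover have "2 * h - 2 * l choose l = 0" if "\<not> 3 * l \<le> 2 * h"
      using that by (intro binomial_eq_0) arith
    ultimately show ?thesis
      by (simp only: coeff_monom_mult coeff_smult coeff_one_plus_X_power) auto
  qed
  then show ?thesis
    by (simp only: binomial_ring coeff_sum) simp
qed

lemma coeff_shifted_cubic_power:
  fixes a c :: int
  shows "Polynomial.coeff (([:a, 1:] ^ 3 - [:c:]) ^ h) N
    = (\<Sum>i\<le>h. int (h choose i) * (- c) ^ (h - i) * (if N \<le> 3 * i then int (3 * i choose N) * a ^ (3 * i - N) else 0))"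
proof -
  have "[:a, 1:] ^ 3 - [:c:] = [:a, 1:] ^ 3 + [:-c:]" by simp
  then have "([:a, 1:] ^ 3 - [:c:]) ^ h
    = (\<Sum>i\<le>h. Polynomial.smult (int (h choose i) * (- c) ^ (h - i)) ([:a, 1:] ^ (3 * i)))"
    by (simp only: binomial_ring power_mult) (simp add: poly_const_pow of_nat_poly mult_ac)
  moreover have "Polynomial.coeff ([:a, 1:] ^ (3 * i)) N
     = (if N \<le> 3 * i then int (3 * i choose N) * a ^ (3 * i - N) else 0)" for i
    by (simp add: coeff_linear_poly_power coeff_eq_0 degree_linear_power)
  ultimately show ?thesis
    by (simp only: coeff_sum coeff_smult)
qed

context prime_gt_3
begin

text \<open>A second description of \<open>a3\<close> modulo \<open>p\<close>: rewrite
  \<open>2 l choose l\<close> through \<open>(p - 1) / 2\<close> and \<open>3 l choose l\<close> by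
  upper negation at \<open>n = 2 l\<close>. The signs cancel.\<close>

lemma cong_a3_half:
  assumes "l < p"
  shows "[a3 l = int ((p - 1) div 2 choose l) * 4 ^ l * int (p - 1 - 2 * l choose l)] (mod int p)"
proof -
  define h where "h = (p - 1) div 2"
  have "[a3 l = ((- 4) ^ l * int (h choose l)) * int (3 * l choose l)] (mod int p)"
    unfolding a3_def h_def by (rule cong_mult[OF cong_central_binomial[OF assms] cong_refl])
  moreover have "[((- 4) ^ l * int (h choose l)) * int (3 * l choose l)
      = int (h choose l) * 4 ^ l * int (p - 1 - 2 * l choose l)] (mod int p)"
  proof (cases "2 * l < p")
    case True
    have eq: "(- 4) ^ l = 4 ^ l * (- 1 :: int) ^ l"
      by (simp flip: power_mult_distrib)
    have "[int (p - 1 - 2 * l choose l) = (- 1) ^ l * int (3 * l choose l)] (mod int p)"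
      using cong_binomial_neg[OF assms True] by simp
    from cong_mult[OF cong_refl cong_sym[OF this], of "int (h choose l) * 4 ^ l"]
    show ?thesis
      by (simp only: eq mult_ac)
  next
    \<comment> \<open>Here \<open>l\<close> exceeds \<open>(p - 1) / 2\<close>, so both sides vanish
      whatever the truncated difference \<open>p - 1 - 2 * l\<close> is.\<close>
    case False
    then have "h choose l = 0"
      using p_gt_3 unfolding h_def by (intro binomial_eq_0) linarith
    then show ?thesis by (simp add: binomial_eq_0)
  qed
  ultimately show ?thesis
    unfolding h_def by (rule cong_trans)
qed

text \<open>The coefficient is the one that defines the Hasse invariant of
  \<open>z^2 = 4 y^3 + (27 - m) (y + 1)^2\<close>.\<close>

lemma cong_G_sum_cubic:
  "[G_sum m = (27 - m) ^ ((p - 1) div 2) * Polynomial.coeff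
     ((Polynomial.monom 4 3 + Polynomial.smult (27 - m) ([:1, 1:] ^ 2)) ^ ((p - 1) div 2)) (p - 1)] (mod int p)"
proof -
  define h w where "h = (p - 1) div 2" and "w = 27 - m"
  let ?c = "\<lambda>l. int (h choose l) * 4 ^ l * int (2 * h - 2 * l choose l)"
  have h: "p - 1 = 2 * h" "h < p"
    using odd_p p_gt_3 unfolding h_def by auto
  have terms: "[(\<Sum>l<p. a3 l * w ^ (2 * h - l)) = (\<Sum>l<p. ?c l * w ^ (2 * h - l))] (mod int p)"
    using cong_a3_half unfolding h_def[symmetric] h(1)
    by (intro cong_sum cong_mult cong_refl) simp
  have 1: "(\<Sum>l<p. ?c l * w ^ (2 * h - l)) = (\<Sum>l\<le>h. ?c l * w ^ (2 * h - l))"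
    by (rule sum.mono_neutral_right) (use h in auto)
  have 2: "(\<Sum>l\<le>h. ?c l * w ^ (2 * h - l)) = (\<Sum>l\<le>h. w ^ h * (?c l * w ^ (h - l)))"
  proof (intro sum.cong refl)
    fix l assume "l \<in> {..h}"
    then have "w ^ (2 * h - l) = w ^ h * w ^ (h - l)"
      by (simp add: mult_2 flip: power_add)
    then show "?c l * w ^ (2 * h - l) = w ^ h * (?c l * w ^ (h - l))"
      by simp
  qed
  have "[G_sum m = (\<Sum>l\<le>h. w ^ h * (?c l * w ^ (h - l)))] (mod int p)"
    using cong_trans[OF cong_G_sum[of m, folded w_def, unfolded h(1)] terms] unfolding 1 2 .
  moreover have "2 * h div 2 = h"
    by simp
  ultimately show ?thesis
    unfolding w_def[symmetric] h(1) by (simp only: coeff_cubic_power sum_distrib_left)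
qed

text \<open>The prime divides \<open>j!\<close> but neither \<open>(p - 1)!\<close> nor
  \<open>(j - p + 1)!\<close>.\<close>

lemma dvd_choose_pred:
  assumes "p \<le> j" "j \<le> 2 * p - 2"
  shows "p dvd j choose (p - 1)"
proof -
  have "fact (p - 1) * fact (j - (p - 1)) * (j choose (p - 1)) = (fact j :: nat)"
    by (rule binomial_fact_lemma) (use assms in auto)
  then have "p dvd fact (p - 1) * fact (j - (p - 1)) * (j choose (p - 1))"
    using prime_dvd_fact_iff[OF prime_p] assms by simp
  then show ?thesis
    using assms p_gt_3 prime_p by (auto simp: prime_dvd_mult_iff prime_dvd_fact_iff)
qed

text \<open>Terms with \<open>p \<le> 3 i\<close> vanish because \<open>3 i \<le> 2 p - 2\<close>,
  so modulo \<open>p\<close> the coefficient does not depend on the shift \<open>a\<close>.\<close>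

lemma cong_coeff_shifted_cubic:
  fixes a c :: int
  assumes "h = (p - 1) div 2"
  shows "[Polynomial.coeff (([:a, 1:] ^ 3 - [:c:]) ^ h) (p - 1)
     = (\<Sum>i\<le>h. if 3 * i = p - 1 then int (h choose i) * (- c) ^ (h - i) else 0)] (mod int p)"
  unfolding coeff_shifted_cubic_power
proof (rule cong_sum)
  fix i assume i: "i \<in> {..h}"
  consider "3 * i < p - 1" | "3 * i = p - 1" | "p \<le> 3 * i" by linarith
  then show "[int (h choose i) * (- c) ^ (h - i)
      * (if p - 1 \<le> 3 * i then int (3 * i choose (p - 1)) * a ^ (3 * i - (p - 1)) else 0)
    = (if 3 * i = p - 1 then int (h choose i) * (- c) ^ (h - i) else 0)] (mod int p)"
  proof cases
    case 3
    moreover have "3 * i \<le> 2 * p - 2"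
      using i assms by auto
    ultimately have "int p dvd int (3 * i choose (p - 1))"
      using dvd_choose_pred by simp
    then show ?thesis
      using 3 p_gt_3 by (auto simp: cong_0_iff)
  qed auto
qed

lemma cong_four_power_half: "[4 ^ ((p - 1) div 2) = 1] (mod int p)"
proof -
  have "(4 :: int) ^ ((p - 1) div 2) = 2 ^ (p - 1)"
    using odd_p power_mult[of "2 :: int" 2 "(p - 1) div 2"] by simp
  then show ?thesis
    using fermat_int[of 2] not_dvd_small[of 2] p_gt_3 by simp
qed

lemma cong_G_sum_3:
  assumes "h = (p - 1) div 2"
  shows "[G_sum 3 = 24 ^ h * (\<Sum>i\<le>h. if 3 * i = p - 1 then int (h choose i) * (- 2) ^ (h - i) else 0)] (mod int p)"
proof -
  have "Polynomial.monom 4 3 + Polynomial.smult (27 - 3) ([:1, 1:] ^ 2)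
      = Polynomial.smult 4 ([:2, 1:] ^ 3 - [:2 :: int:])"
    by (simp add: power2_eq_square power3_eq_cube numeral_3_eq_3 monom_Suc monom_0)
  then have "[G_sum 3 = 24 ^ h * (4 ^ h * Polynomial.coeff (([:2, 1:] ^ 3 - [:2:]) ^ h) (p - 1))] (mod int p)"
    using cong_G_sum_cubic[of 3] assms by (simp add: smult_power)
  moreover have "[24 ^ h * (4 ^ h * Polynomial.coeff (([:2, 1:] ^ 3 - [:2:]) ^ h) (p - 1))
     = 24 ^ h * (1 * (\<Sum>i\<le>h. if 3 * i = p - 1 then int (h choose i) * (- 2) ^ (h - i) else 0))] (mod int p)"
    using cong_four_power_half assms cong_coeff_shifted_cubic[OF assms, of 2 2]
    by (intro cong_mult cong_refl) auto
  ultimately show ?thesis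
    using cong_trans by fastforce
qed

lemma cong_G_sum_3_2_mod_3:
  assumes "p mod 3 = 2"
  shows "[G_sum 3 = 0] (mod int p)"
proof -
  have "3 * i \<noteq> p - 1" for i
    using assms by presburger
  then show ?thesis
    using cong_G_sum_3 by simp
qed

text \<open>Reversing \<open>(1 + x) (- m - 27 x)\<close> yields, up to a constant, the quadratic
  for \<open>27^2 / m\<close>, and \<open>3 * 243 = 27^2\<close>.\<close>

lemma cong_G_sum_3_243:
  "[G_sum 3 = 24 ^ (p - 1 - p div 3) * (- 3) ^ (p div 3) * Polynomial.coeff ([:1, 10, 9:] ^ (p div 3)) (p div 3)] (mod int p)"
  "[G_sum 243 = (- 216) ^ (p - 1 - p div 3) * (- 27) ^ (p div 3) * Polynomial.coeff ([:1, 10, 9:] ^ (p div 3)) (p div 3)] (mod int p)"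
proof -
  have "[:1, 1:] * [:-3, -27 :: int:] = Polynomial.smult (-3) [:1, 10, 9:]"
    "[:1, 1:] * [:-243, -27 :: int:] = Polynomial.smult (-27) [:9, 10, 1:]"
    by simp_all
  moreover have "Polynomial.coeff ([:9, 10, 1:] ^ q) q = Polynomial.coeff ([:1, 10, 9 :: int:] ^ q) q" for q
    using coeff_power_reflect[of "[:1, 10, 9:]" q] by (simp add: reflect_poly_pCons)
  ultimately show
    "[G_sum 3 = 24 ^ (p - 1 - p div 3) * (- 3) ^ (p div 3) * Polynomial.coeff ([:1, 10, 9:] ^ (p div 3)) (p div 3)] (mod int p)"
    "[G_sum 243 = (- 216) ^ (p - 1 - p div 3) * (- 27) ^ (p div 3) * Polynomial.coeff ([:1, 10, 9:] ^ (p div 3)) (p div 3)] (mod int p)"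
    using cong_G_sum_coeff[of 3] cong_G_sum_coeff[of 243]
    by (simp_all add: smult_power mult.assoc del: smult_minus_left mult_pCons_left mult_pCons_right smult_pCons)
qed

text \<open>As \<open>- 216 = - 9 * 24\<close> and \<open>- 27 = 9 * (- 3)\<close>, the two
  prefactors differ by \<open>(- 1) ^ s * 9 ^ (p - 1)\<close>, to which Fermat applies.\<close>

lemma cong_G_sum_243_eq: "[G_sum 243 = (- 1) ^ (p - 1 - p div 3) * G_sum 3] (mod int p)"
proof -
  define q E where "q = p div 3" and "E = Polynomial.coeff ([:1, 10, 9 :: int:] ^ q) q"
  define s where "s = p - 1 - q"
  have q: "p - 1 = s + q"
    using p_gt_3 unfolding q_def s_def by simp
  have split: "(- 216) ^ s = (- 1) ^ s * (24 ^ s * 9 ^ s :: int)" "(- 27) ^ q = (- 3) ^ q * (9 ^ q :: int)"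
    by (simp_all flip: power_mult_distrib)
  have "[9 ^ (p - 1) = 1] (mod int p)"
  proof (rule fermat_int)
    have "\<not> int p dvd 3" using not_dvd_small[of 3] p_gt_3 by simp
    then show "\<not> int p dvd 9" using prime_dvd_mult_iff[OF prime_int_p, of 3 3] by simp
  qed
  then have 1: "[9 ^ (p - 1) * ((- 1) ^ s * (24 ^ s * (- 3) ^ q * E)) = 1 * ((- 1) ^ s * G_sum 3)] (mod int p)"
    using cong_sym[OF cong_G_sum_3_243(1)] unfolding q_def s_def E_def
    by (intro cong_mult cong_refl)
  have 2: "(- 216) ^ s * (- 27) ^ q * E = 9 ^ (p - 1) * ((- 1) ^ s * (24 ^ s * (- 3) ^ q * E))"
    unfolding split q power_add by (simp only: mult_ac)
  have "[G_sum 243 = (- 216) ^ s * (- 27) ^ q * E] (mod int p)"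
    using cong_G_sum_3_243(2) unfolding q_def s_def E_def .
  from cong_trans[OF this[unfolded 2] 1] show ?thesis
    unfolding s_def q_def by simp
qed

lemma cong_G_sum_minus_27:
  "[G_sum (- 27) = (if even (p div 3) then int ((p - 1) div 2 choose (p div 3 div 2)) else 0)] (mod int p)"
proof -
  define q h s where "q = p div 3" and "h = (p - 1) div 2" and "s = p - 1 - q"
  have q: "p - 1 = s + q"
    using p_gt_3 unfolding q_def s_def by simp
  have "[:1, 1:] * [:27, -27 :: int:] = Polynomial.smult 27 [:1, 0, -1:]"
    by simp
  then have G: "[G_sum (- 27) = 54 ^ s * (27 ^ q * Polynomial.coeff ([:1, 0, -1:] ^ q) q)] (mod int p)"
    using cong_G_sum_coeff[of "-27"] unfolding q_def[symmetric] s_def[symmetric]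
    by (simp add: smult_power del: mult_pCons_left mult_pCons_right smult_pCons)
  show ?thesis
  proof (cases "even q")
    case True
    then obtain t where t: "q = 2 * t" by blast
    have "t < p"
      using t p_gt_3 unfolding q_def by linarith
    \<comment> \<open>Here \<open>(- 1) ^ t * (- 4) ^ t = 2 ^ q\<close>, so all constants merge into
      \<open>54 ^ (p - 1)\<close>.\<close>
    have 1: "54 ^ s * (27 ^ q * ((- 1) ^ t * ((- 4) ^ t * int (h choose t)))) = 54 ^ (p - 1) * int (h choose t)"
    proof -
      have "(54 :: int) ^ q = 27 ^ q * ((- 1) ^ t * (- 4) ^ t)"
        unfolding t power_mult by (simp flip: power_mult_distrib)
      then show ?thesis
        unfolding q power_add by (simp only: mult_ac)
    qed
    have 2: "[54 ^ s * (27 ^ q * ((- 1) ^ t * int (2 * t choose t)))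
        = 54 ^ s * (27 ^ q * ((- 1) ^ t * ((- 4) ^ t * int (h choose t))))] (mod int p)"
      unfolding h_def by (intro cong_mult[OF cong_refl] cong_central_binomial \<open>t < p\<close>)
    have 3: "[54 ^ (p - 1) * int (h choose t) = 1 * int (h choose t)] (mod int p)"
    proof (intro cong_mult cong_refl fermat_int)
      have "\<not> int p dvd 2" "\<not> int p dvd 3" using not_dvd_small[of 2] not_dvd_small[of 3] p_gt_3 by simp_all
      then show "\<not> int p dvd 54"
        using prime_dvd_mult_iff[OF prime_int_p, of 2 27] prime_dvd_power[OF prime_int_p, of 3 3] by auto
    qed
    have 4: "Polynomial.coeff ([:1, 0, -1 :: int:] ^ q) q = (- 1) ^ t * int (2 * t choose t)"
      unfolding coeff_one_minus_square_power t by simp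
    have "[G_sum (- 27) = 1 * int (h choose t)] (mod int p)"
      by (rule cong_trans[OF G[unfolded 4] cong_trans[OF 2 3[folded 1]]])
    then show ?thesis
      using True t unfolding q_def[symmetric] h_def[symmetric] by simp
  next
    case False
    then show ?thesis
      using G unfolding coeff_one_minus_square_power q_def by simp
  qed
qed

end

subsection \<open>Character sums\<close>

context prime_gt_3
begin

section \<open>Sums over residue classes\<close>

lemma cong_imp_eq: "x = y" if "[x = y] (mod int p)" "x \<in> {0..<int p}" "y \<in> {0..<int p}"
  using that by (simp add: cong_def)

text \<open>The map \<open>x \<mapsto> h x mod p\<close> is an injective self-map of a finite set,
  hence a permutation.\<close>

lemma sum_reindex_residues:
  fixes f :: "int \<Rightarrow> 'a :: comm_monoid_add"
  assumes f: "\<And>x y. [x = y] (mod int p) \<Longrightarrow> f x = f y"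
    and h: "\<And>x y. [h x = h y] (mod int p) \<Longrightarrow> [x = y] (mod int p)"
  shows "(\<Sum>x\<in>{0..<int p}. f (h x)) = (\<Sum>x\<in>{0..<int p}. f x)"
proof -
  have inj: "inj_on (\<lambda>x. h x mod int p) {0..<int p}"
  proof (rule inj_onI)
    fix x y assume xy: "x \<in> {0..<int p}" "y \<in> {0..<int p}" "h x mod int p = h y mod int p"
    then have "[x = y] (mod int p)"
      using h unfolding cong_def by blast
    then show "x = y"
      using xy cong_imp_eq by blast
  qed
  moreover have "(\<lambda>x. h x mod int p) ` {0..<int p} = {0..<int p}"
    by (rule endo_inj_surj[OF _ _ inj]) (use p_gt_3 in auto)
  ultimately have "bij_betw (\<lambda>x. h x mod int p) {0..<int p} {0..<int p}"
    unfolding bij_betw_def by (rule conjI)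
  then have "(\<Sum>x\<in>{0..<int p}. f x) = (\<Sum>x\<in>{0..<int p}. f (h x mod int p))"
    by (rule sum.reindex_bij_betw[symmetric])
  also have "\<dots> = (\<Sum>x\<in>{0..<int p}. f (h x))"
    by (intro sum.cong refl f) simp
  finally show ?thesis by simp
qed

lemma sum_scale_residues:
  fixes f :: "int \<Rightarrow> 'a :: comm_monoid_add"
  assumes "\<And>x y. [x = y] (mod int p) \<Longrightarrow> f x = f y" "\<not> int p dvd d"
  shows "(\<Sum>x\<in>{0..<int p}. f (d * x)) = (\<Sum>x\<in>{0..<int p}. f x)"
  using assms by (intro sum_reindex_residues) (auto intro: cong_mult_cancel)

lemma sum_shift_residues:
  fixes f :: "int \<Rightarrow> 'a :: comm_monoid_add"
  assumes "\<And>x y. [x = y] (mod int p) \<Longrightarrow> f x = f y"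
  shows "(\<Sum>x\<in>{0..<int p}. f (x + d)) = (\<Sum>x\<in>{0..<int p}. f x)"
  using assms by (intro sum_reindex_residues) (auto simp: cong_add_rcancel)

lemma dvd_mult_iff: "int p dvd a * b \<longleftrightarrow> int p dvd a \<or> int p dvd b"
  using prime_int_p by (rule prime_dvd_mult_iff)

lemma dvd_power_imp: "int p dvd a ^ n \<Longrightarrow> int p dvd a"
  using prime_int_p prime_dvd_power by blast

lemma primitive_root_int:
  obtains g :: int where "\<not> int p dvd g" "\<And>i. [g ^ i = 1] (mod int p) \<longleftrightarrow> p - 1 dvd i"
    "bij_betw (\<lambda>i. g ^ i mod int p) {..<p - 1} {1..<int p}"
proof -
  have "1 < p" using p_gt_3 by simp
  then obtain g where g: "residue_primroot p g"
    using prime_primitive_root_exists[OF _ prime_p] by blast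
  then have cop: "coprime p g" and ord: "ord p g = p - 1"
    using prime_p by (auto simp: residue_primroot_def totient_prime)
  have "bij_betw (\<lambda>i. g ^ i mod p) {..<p - 1} {0<..<p}"
    using residue_primroot_is_generator[OF \<open>1 < p\<close> g] prime_p
    by (simp add: totient_prime totatives_prime)
  moreover have "bij_betw int {0<..<p} {1..<int p}"
    by (rule bij_betwI[of _ _ _ nat]) auto
  ultimately have "bij_betw (int \<circ> (\<lambda>i. g ^ i mod p)) {..<p - 1} {1..<int p}"
    by (rule bij_betw_trans)
  then have "bij_betw (\<lambda>i. int g ^ i mod int p) {..<p - 1} {1..<int p}"
    by (simp add: comp_def zmod_int)
  moreover have "\<not> int p dvd int g"
    using cop \<open>1 < p\<close> by (metis coprime_absorb_left int_dvd_int_iff nat_dvd_1_iff_1 nat_neq_iff)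
  moreover have "[int g ^ i = 1] (mod int p) \<longleftrightarrow> p - 1 dvd i" for i
    using ord_divides[of g i p] ord cong_int_iff[of "g ^ i" 1 p] by simp
  ultimately show ?thesis
    using that by blast
qed

text \<open>If \<open>p - 1\<close> does not divide \<open>j\<close>, scaling by a primitive root
  \<open>g\<close> multiplies the sum by \<open>g ^ j\<close>, which is not 1. Otherwise all nonzero
  \<open>x\<close> contribute 1; \<open>j = 0\<close> is separate since
  \<open>0 ^ 0 = 1\<close>.\<close>

lemma cong_power_sum:
  "[(\<Sum>x\<in>{0..<int p}. x ^ j) = (if 0 < j \<and> p - 1 dvd j then - 1 else 0)] (mod int p)"
proof (cases "p - 1 dvd j")
  case True
  have R: "{0..<int p} = insert 0 {1..<int p}"
    using p_gt_3 by auto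
  show ?thesis
  proof (cases "j = 0")
    case False
    have "[x ^ j = 1] (mod int p)" if x: "x \<in> {1..<int p}" for x
    proof -
      obtain m where "j = (p - 1) * m" using True by blast
      then show ?thesis
        using fermat_int[of x] not_dvd_small[of x] x cong_pow[of "x ^ (p - 1)" 1 "int p" m]
        by (simp add: power_mult)
    qed
    then have "[(\<Sum>x\<in>{1..<int p}. x ^ j) = (\<Sum>x\<in>{1..<int p}. 1)] (mod int p)"
      by (rule cong_sum)
    then have "[(\<Sum>x\<in>{0..<int p}. x ^ j) = int p - 1] (mod int p)"
      using False p_gt_3 unfolding R by (simp add: zero_power of_nat_diff)
    moreover have "[int p - 1 = - 1] (mod int p)"
      by (simp add: cong_iff_dvd_diff)
    ultimately show ?thesis
      using False True by (auto intro: cong_trans)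
  qed (simp add: cong_0_iff)
next
  case False
  obtain g where g: "\<not> int p dvd g" "\<And>i. [g ^ i = 1] (mod int p) \<longleftrightarrow> p - 1 dvd i"
    by (rule primitive_root_int) blast
  \<comment> \<open>Reducing each power makes the summand a function of the residue class, as the
    scaling lemma demands.\<close>
  define s where "s = (\<Sum>x\<in>{0..<int p}. x ^ j mod int p)"
  have s: "[(\<Sum>x\<in>{0..<int p}. x ^ j) = s] (mod int p)"
    unfolding s_def by (intro cong_sum) (simp add: cong_def)
  have "(\<Sum>x\<in>{0..<int p}. (g * x) ^ j mod int p) = s"
    unfolding s_def by (rule sum_scale_residues[OF _ g(1)]) (use cong_pow in \<open>auto simp: cong_def\<close>)
  moreover have "[(\<Sum>x\<in>{0..<int p}. (g * x) ^ j mod int p) = (\<Sum>x\<in>{0..<int p}. g ^ j * (x ^ j mod int p))] (mod int p)"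
    by (intro cong_sum) (simp add: cong_def power_mult_distrib mod_mult_right_eq)
  ultimately have "[s = g ^ j * s] (mod int p)"
    unfolding s_def sum_distrib_left by simp
  then have "int p dvd (g ^ j - 1) * s"
    by (simp add: cong_iff_dvd_diff algebra_simps dvd_diff_commute)
  moreover have "\<not> int p dvd g ^ j - 1"
    using g(2)[of j] False by (simp add: cong_iff_dvd_diff)
  ultimately have "[s = 0] (mod int p)"
    by (simp add: dvd_mult_iff cong_0_iff)
  then show ?thesis
    using s False cong_trans by auto
qed

section \<open>The Legendre symbol and its correlations\<close>

definition chi :: "int \<Rightarrow> int" where
  "chi a = Legendre a (int p)"

lemma chi_range: "chi a = -1 \<or> chi a = 0 \<or> chi a = 1"
  by (simp add: chi_def Legendre_def)

lemma chi_eq_0_iff: "chi a = 0 \<longleftrightarrow> int p dvd a"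
  by (simp add: chi_def Legendre_def cong_0_iff)

text \<open>Two numbers among -1, 0, 1 differ by at most 2, which is less than
  \<open>p\<close>.\<close>

lemma chi_eqI:
  assumes "[chi a = b] (mod int p)" "b = -1 \<or> b = 0 \<or> b = 1"
  shows "chi a = b"
proof -
  have "int p dvd chi a - b"
    using assms by (simp add: cong_iff_dvd_diff)
  moreover have "\<bar>chi a - b\<bar> < int p"
    using chi_range[of a] assms(2) p_gt_3 by auto
  ultimately show ?thesis
    using dvd_imp_le_int[of "chi a - b" "int p"] by auto
qed

lemma cong_chi: "[chi a = a ^ ((p - 1) div 2)] (mod int p)"
  unfolding chi_def using euler_criterion prime_p p_gt_3 by simp

lemma chi_cong: "chi a = chi b" if "[a = b] (mod int p)"
  by (rule chi_eqI[OF _ chi_range])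
    (meson cong_chi cong_pow[OF that] cong_sym cong_trans)

lemma chi_mult: "chi (a * b) = chi a * chi b"
proof (rule chi_eqI)
  have "[chi (a * b) = a ^ ((p - 1) div 2) * b ^ ((p - 1) div 2)] (mod int p)"
    using cong_chi[of "a * b"] by (simp add: power_mult_distrib)
  then show "[chi (a * b) = chi a * chi b] (mod int p)"
    using cong_mult[OF cong_chi cong_chi] cong_sym cong_trans by blast
  show "chi a * chi b = -1 \<or> chi a * chi b = 0 \<or> chi a * chi b = 1"
    using chi_range[of a] chi_range[of b] by auto
qed

lemma chi_mult_self: "chi a * chi a = (if int p dvd a then 0 else 1)"
  using chi_range[of a] chi_eq_0_iff[of a] by auto

lemma chi_square: "chi (a\<^sup>2) = (if int p dvd a then 0 else 1)"
  by (simp add: power2_eq_square chi_mult chi_mult_self)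

lemma chi_cube: "chi (a ^ 3) = chi a"
  using chi_range[of a] by (auto simp: power3_eq_cube chi_mult)

text \<open>A primitive root \<open>g\<close> has \<open>chi g \<noteq> 1\<close> by Euler's
  criterion, and scaling by \<open>g\<close> multiplies the sum by \<open>chi g\<close>.\<close>

lemma sum_chi: "(\<Sum>x\<in>{0..<int p}. chi x) = 0"
proof -
  obtain g where g: "\<not> int p dvd g" "\<And>i. [g ^ i = 1] (mod int p) \<longleftrightarrow> p - 1 dvd i"
    by (rule primitive_root_int) blast
  have "chi g \<noteq> 1"
  proof
    assume "chi g = 1"
    then have "p - 1 dvd (p - 1) div 2"
      using g(2)[of "(p - 1) div 2"] cong_chi[of g] by (simp add: cong_sym_eq)
    then show False
      using p_gt_3 by (auto dest!: dvd_imp_le)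
  qed
  moreover have "(\<Sum>x\<in>{0..<int p}. chi x) = chi g * (\<Sum>x\<in>{0..<int p}. chi x)"
    using sum_scale_residues[of chi g, OF chi_cong g(1)] by (simp add: chi_mult sum_distrib_left)
  ultimately show ?thesis by simp
qed

lemma sum_chi_shift: "(\<Sum>x\<in>{0..<int p}. chi (x + d)) = 0"
  using sum_shift_residues[of chi d] chi_cong sum_chi by simp

text \<open>The sum depends only on \<open>d = b - a\<close>; call it \<open>K d\<close>. Scaling
  shows that \<open>K\<close> is constant on units, the sum of all \<open>K d\<close> is 0, and
  \<open>K 0 = p - 1\<close>. Hence \<open>K 1 = - 1\<close>.\<close>

lemma sum_chi_mult:
  "(\<Sum>c\<in>{0..<int p}. chi (a + c) * chi (b + c)) = (if [a = b] (mod int p) then int p else 0) - 1"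
proof -
  define K where "K d = (\<Sum>c\<in>{0..<int p}. chi c * chi (c + d))" for d
  have R: "{0..<int p} = insert 0 {1..<int p}"
    using p_gt_3 by auto
  have K_cong: "K d = K e" if "[d = e] (mod int p)" for d e
    unfolding K_def using that by (intro sum.cong refl arg_cong2[of _ _ _ _ "(*)"] chi_cong cong_add) auto
  have K_scale: "K d = K 1" if "\<not> int p dvd d" for d
  proof -
    have "K d = (\<Sum>c\<in>{0..<int p}. chi (d * c) * chi (d * c + d))"
      unfolding K_def
      by (rule sum_scale_residues[symmetric, OF _ that]) (intro arg_cong2[of _ _ _ _ "(*)"] chi_cong cong_add; simp)
    also have "\<dots> = (\<Sum>c\<in>{0..<int p}. (chi d * chi d) * (chi c * chi (c + 1)))"
    proof (intro sum.cong refl)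
      fix c
      have "d * c + d = d * (c + 1)" by (simp add: algebra_simps)
      then show "chi (d * c) * chi (d * c + d) = (chi d * chi d) * (chi c * chi (c + 1))"
        by (simp only: chi_mult mult_ac)
    qed
    finally show ?thesis
      using that by (simp add: chi_mult_self K_def)
  qed
  have K_0: "K 0 = int p - 1"
    unfolding K_def chi_mult_self add_0_right R using p_gt_3
    by (simp add: chi_mult_self zdvd_not_zless of_nat_diff)
  have units: "(\<Sum>d\<in>{1..<int p}. K d) = (\<Sum>d\<in>{1..<int p}. K 1)"
    by (intro sum.cong refl K_scale) (simp add: zdvd_not_zless)
  have "(\<Sum>d\<in>{0..<int p}. K d) = (\<Sum>c\<in>{0..<int p}. chi c * (\<Sum>d\<in>{0..<int p}. chi (d + c)))"
    unfolding K_def sum_distrib_left by (subst sum.swap) (simp add: add.commute)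
  also have "\<dots> = 0"
    by (simp add: sum_chi_shift)
  also have "(\<Sum>d\<in>{0..<int p}. K d) = K 0 + (\<Sum>d\<in>{1..<int p}. K 1)"
    unfolding R units[symmetric] by simp
  finally have "(int p - 1) * (1 + K 1) = 0"
    using p_gt_3 by (simp add: K_0 algebra_simps of_nat_diff)
  then have K_1: "K 1 = - 1"
    using p_gt_3 by auto
  have "(\<Sum>c\<in>{0..<int p}. chi (a + c) * chi (b + c)) = K (b - a)"
  proof -
    have "(\<Sum>c\<in>{0..<int p}. chi (c + a) * chi (c + a + (b - a))) = K (b - a)"
      unfolding K_def
      by (rule sum_shift_residues) (intro arg_cong2[of _ _ _ _ "(*)"] chi_cong cong_add; simp)
    then show ?thesis
      by (simp add: add.commute)
  qed
  also have "\<dots> = (if [a = b] (mod int p) then int p else 0) - 1"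
  proof (cases "[a = b] (mod int p)")
    case True
    then have "K (b - a) = K 0"
      by (intro K_cong) (simp add: cong_iff_dvd_diff dvd_diff_commute)
    then show ?thesis using True K_0 by simp
  next
    case False
    then have "\<not> int p dvd b - a"
      by (simp add: cong_iff_dvd_diff dvd_diff_commute)
    then show ?thesis using False K_scale[of "b - a"] K_1 by simp
  qed
  finally show ?thesis .
qed

lemma card_square_roots:
  "int (card {y \<in> {0..<int p}. [y\<^sup>2 = a] (mod int p)}) = 1 + chi a"
proof (cases "QuadRes (int p) a")
  case True
  then obtain y0 where y0: "[y0\<^sup>2 = a] (mod int p)"
    unfolding QuadRes_def by blast
  have iff: "[y\<^sup>2 = a] (mod int p) \<longleftrightarrow> [y = y0] (mod int p) \<or> [y = - y0] (mod int p)" for y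
  proof -
    have "[y\<^sup>2 = a] (mod int p) \<longleftrightarrow> [y\<^sup>2 = y0\<^sup>2] (mod int p)"
      using y0 cong_sym cong_trans by blast
    also have "\<dots> \<longleftrightarrow> int p dvd (y - y0) * (y + y0)"
      by (simp add: cong_iff_dvd_diff power2_eq_square algebra_simps)
    finally show ?thesis
      by (simp add: dvd_mult_iff cong_iff_dvd_diff)
  qed
  have set: "{y \<in> {0..<int p}. [y\<^sup>2 = a] (mod int p)} = {y0 mod int p, (- y0) mod int p}"
    using p_gt_3 unfolding iff by (auto simp: cong_def)
  show ?thesis
  proof (cases "int p dvd a")
    case True
    then have "int p dvd y0"
      using y0 cong_dvd_iff[of "y0\<^sup>2" a "int p"] dvd_power_imp by blast
    then show ?thesis
      using True chi_eq_0_iff[of a] unfolding set by simp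
  next
    case False
    then have "\<not> int p dvd y0"
      using y0 cong_dvd_iff[of "y0\<^sup>2" a "int p"] by (metis dvd_power zero_less_numeral dvd_trans)
    moreover have "\<not> int p dvd 2" using not_dvd_small[of 2] p_gt_3 by simp
    ultimately have "\<not> int p dvd y0 - (- y0)"
      using dvd_mult_iff[of 2 y0] by (metis diff_minus_eq_add mult_2)
    then have "y0 mod int p \<noteq> (- y0) mod int p"
      by (simp add: mod_eq_dvd_iff)
    moreover have "chi a = 1"
      using False True by (simp add: chi_def Legendre_def cong_0_iff)
    ultimately show ?thesis
      unfolding set by simp
  qed
next
  case False
  then have "\<not> [a = 0] (mod int p)"
    unfolding QuadRes_def using cong_sym[of a 0 "int p"] by (metis zero_power2)
  then have "chi a = - 1"
    using False by (simp add: chi_def Legendre_def)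
  moreover have "{y \<in> {0..<int p}. [y\<^sup>2 = a] (mod int p)} = {}"
    using False unfolding QuadRes_def by blast
  ultimately show ?thesis
    by (simp only: card.empty)
qed

end

subsection \<open>Character sums over cubics\<close>

context prime_gt_3
begin

lemma dvd_residue_iff: "int p dvd x \<longleftrightarrow> x = 0" if "x \<in> {0..<int p}"
  using that not_dvd_small[of x] by (cases "0 < x") auto

lemma cong_power_0_iff: "[x ^ n = 0] (mod int p) \<longleftrightarrow> int p dvd x" if "0 < n"
  using that dvd_power_imp[of x n] by (auto simp: cong_0_iff intro: dvd_trans[OF _ dvd_power])

text \<open>The affine curve \<open>y^2 = x^3 + c\<close> has \<open>p + mordell_sum c\<close>
  points modulo \<open>p\<close>.\<close>

definition mordell_sum :: "int \<Rightarrow> int" where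
  "mordell_sum c = (\<Sum>x\<in>{0..<int p}. chi (x ^ 3 + c))"

lemma mordell_sum_cong: "mordell_sum c = mordell_sum d" if "[c = d] (mod int p)"
  unfolding mordell_sum_def using that by (intro sum.cong refl chi_cong cong_add) auto

lemma mordell_sum_0: "mordell_sum 0 = 0"
  unfolding mordell_sum_def by (simp add: chi_cube sum_chi)

lemma mordell_sum_mult_cube:
  assumes "\<not> int p dvd d"
  shows "mordell_sum (c * d ^ 3) = chi d * mordell_sum c"
proof -
  have "mordell_sum (c * d ^ 3) = (\<Sum>x\<in>{0..<int p}. chi ((d * x) ^ 3 + c * d ^ 3))"
    unfolding mordell_sum_def
    by (rule sum_scale_residues[symmetric, OF _ assms]) (intro chi_cong cong_add cong_pow; simp)
  also have "\<dots> = (\<Sum>x\<in>{0..<int p}. chi d * chi (x ^ 3 + c))"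
  proof (intro sum.cong refl)
    fix x
    have "(d * x) ^ 3 + c * d ^ 3 = d ^ 3 * (x ^ 3 + c)"
      by (simp add: algebra_simps)
    then show "chi ((d * x) ^ 3 + c * d ^ 3) = chi d * chi (x ^ 3 + c)"
      by (simp only: chi_mult chi_cube)
  qed
  finally show ?thesis
    by (simp add: mordell_sum_def sum_distrib_left)
qed

text \<open>For each \<open>x\<close> the sum over \<open>c\<close> is a correlation with shift
  \<open>x^3\<close>: it is \<open>p - 1\<close> at \<open>x = 0\<close> and \<open>- 1\<close> at
  the other \<open>p - 1\<close> residues.\<close>

lemma sum_chi_mult_mordell_sum: "(\<Sum>c\<in>{0..<int p}. chi c * mordell_sum c) = 0"
proof -
  have cube: "[0 = x ^ 3] (mod int p) \<longleftrightarrow> x = 0" if "x \<in> {0..<int p}" for x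
    using cong_power_0_iff[of 3 x] dvd_residue_iff[OF that] by (simp add: cong_sym_eq)
  have "(\<Sum>c\<in>{0..<int p}. chi c * mordell_sum c) = (\<Sum>x\<in>{0..<int p}. \<Sum>c\<in>{0..<int p}. chi (0 + c) * chi (x ^ 3 + c))"
    unfolding mordell_sum_def sum_distrib_left by (subst sum.swap) simp
  also have "\<dots> = (\<Sum>x\<in>{0..<int p}. (if x = 0 then int p else 0) - 1)"
    unfolding sum_chi_mult by (intro sum.cong refl) (simp add: cube)
  also have "\<dots> = 0"
    using p_gt_3 by (simp add: sum_subtractf)
  finally show ?thesis .
qed

lemma sum_mult_nat_periodic:
  fixes f :: "nat \<Rightarrow> int"
  assumes "\<And>i. f (i + 3) = f i"
  shows "(\<Sum>i<3 * n. f i) = int n * (f 0 + f 1 + f 2)"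
proof (induction n)
  case (Suc n)
  have "f (3 * n + j) = f j" for j
  proof (induction n)
    case (Suc n)
    then show ?case
      using assms[of "3 * n + j"] by (simp add: ac_simps)
  qed simp
  from this[of 0] this[of 1] this[of 2] have
    "(\<Sum>i<3 * Suc n. f i) = (\<Sum>i<3 * n. f i) + (f 0 + f 1 + f 2)"
    by (simp add: numeral_eq_Suc)
  then show ?case
    unfolding Suc.IH by (simp add: algebra_simps)
qed simp

end

section \<open>Cubic character sums for primes that are 1 modulo 6\<close>

locale prime_1_mod_6 = prime_gt_3 +
  fixes r :: nat
  assumes p_eq: "p = 6 * r + 1"
begin

lemma half_p: "(p - 1) div 2 = 3 * r" "p - 1 = 6 * r" "0 < r"
  using p_eq p_gt_3 by auto

text \<open>Replace \<open>chi\<close> by the power \<open>3 r\<close> and expand. The power sum of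
  exponent \<open>3 i\<close> with \<open>i \<le> 3 r\<close> survives only if \<open>6 r\<close>
  divides \<open>3 i > 0\<close>, that is, for \<open>i = 2 r\<close>.\<close>

lemma cong_mordell_sum: "[mordell_sum c = - (int (3 * r choose r) * c ^ r)] (mod int p)"
proof -
  let ?s = "\<lambda>i. \<Sum>x\<in>{0..<int p}. x ^ (3 * i)"
  have "[mordell_sum c = (\<Sum>x\<in>{0..<int p}. (x ^ 3 + c) ^ (3 * r))] (mod int p)"
    unfolding mordell_sum_def by (intro cong_sum) (metis cong_chi half_p(1))
  moreover have "(\<Sum>x\<in>{0..<int p}. (x ^ 3 + c) ^ (3 * r))
     = (\<Sum>i\<le>3 * r. int (3 * r choose i) * c ^ (3 * r - i) * ?s i)"
    unfolding binomial_ring sum_distrib_left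
    by (subst sum.swap) (simp add: mult_ac flip: power_mult)
  moreover have "[(\<Sum>i\<le>3 * r. int (3 * r choose i) * c ^ (3 * r - i) * ?s i)
    = (\<Sum>i\<le>3 * r. int (3 * r choose i) * c ^ (3 * r - i) * (if i = 2 * r then - 1 else 0))] (mod int p)"
  proof (intro cong_sum cong_mult cong_refl)
    fix i assume i: "i \<in> {..3 * r}"
    have "0 < 3 * i \<and> p - 1 dvd 3 * i \<longleftrightarrow> i = 2 * r"
    proof
      assume *: "0 < 3 * i \<and> p - 1 dvd 3 * i"
      then obtain m where m: "3 * i = 6 * r * m"
        unfolding half_p by blast
      then have "i = 2 * r * m" by simp
      then have "m \<noteq> 0" "2 * r * m \<le> 3 * r"
        using * i by auto
      then have "m = 1"
        using half_p(3) by (cases m; cases "m - 1") auto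
      then show "i = 2 * r"
        using \<open>i = 2 * r * m\<close> by simp
    qed (use half_p in auto)
    then show "[?s i = (if i = 2 * r then - 1 else 0)] (mod int p)"
      using cong_power_sum[of "3 * i"] by simp
  qed
  moreover have "(\<Sum>i\<le>3 * r. int (3 * r choose i) * c ^ (3 * r - i) * (if i = 2 * r then - 1 else 0))
    = - (int (3 * r choose r) * c ^ r)"
    using binomial_symmetric[of r "3 * r"] by (simp add: if_distrib[of "(*) _"] sum.delta cong: if_cong)
  ultimately show ?thesis
    using cong_trans by fastforce
qed

lemma primitive_cube_root: obtains w :: int where "[w\<^sup>2 + w + 1 = 0] (mod int p)"
proof -
  obtain g where g: "\<not> int p dvd g" "\<And>i. [g ^ i = 1] (mod int p) \<longleftrightarrow> p - 1 dvd i"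
    by (rule primitive_root_int) blast
  have "\<not> int p dvd g ^ (2 * r) - 1"
    using g(2)[of "2 * r"] half_p by (auto simp: cong_iff_dvd_diff dest: dvd_imp_le)
  moreover have "(g ^ (2 * r) - 1) * ((g ^ (2 * r))\<^sup>2 + g ^ (2 * r) + 1) = g ^ (6 * r) - 1"
    by (simp add: algebra_simps power2_eq_square flip: power_add)
  moreover have "int p dvd g ^ (6 * r) - 1"
    using g(2)[of "6 * r"] half_p by (simp add: cong_iff_dvd_diff)
  ultimately have "int p dvd (g ^ (2 * r))\<^sup>2 + g ^ (2 * r) + 1"
    by (metis dvd_mult_iff)
  then show ?thesis
    using that by (simp add: cong_0_iff)
qed

lemma not_dvd_3: "\<not> int p dvd 3" and not_dvd_2: "\<not> int p dvd 2"
  using not_dvd_small[of 3] not_dvd_small[of 2] p_gt_3 by simp_all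

lemma primitive_cube_root_minus_1:
  assumes "[w\<^sup>2 + w + 1 = 0] (mod int p)"
  shows "\<not> int p dvd w - 1"
proof
  assume "int p dvd w - 1"
  moreover have "3 = w\<^sup>2 + w + 1 - (w - 1) * (w + 2)"
    by (simp add: algebra_simps power2_eq_square)
  ultimately show False
    using assms not_dvd_3 by (metis cong_0_iff dvd_diff dvd_mult2)
qed

lemma primitive_cube_root_square:
  assumes "[w\<^sup>2 + w + 1 = 0] (mod int p)"
  shows "[(2 * w + 1)\<^sup>2 = - 3] (mod int p)" and "\<not> int p dvd 2 * w + 1"
proof -
  have "(2 * w + 1)\<^sup>2 - (- 3) = 4 * (w\<^sup>2 + w + 1)"
    by (simp add: algebra_simps power2_eq_square)
  moreover have "int p dvd 4 * (w\<^sup>2 + w + 1)"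
    using assms by (intro dvd_mult) (simp add: cong_0_iff)
  ultimately show "[(2 * w + 1)\<^sup>2 = - 3] (mod int p)"
    by (simp only: cong_iff_dvd_diff)
  then show "\<not> int p dvd 2 * w + 1"
    using not_dvd_3 cong_dvd_iff[of "(2 * w + 1)\<^sup>2" "-3" "int p"]
    by (metis dvd_minus_iff dvd_mult power2_eq_square)
qed

lemma chi_minus_3: "chi (- 3) = 1"
proof -
  obtain w where w: "[w\<^sup>2 + w + 1 = 0] (mod int p)"
    by (rule primitive_cube_root)
  show ?thesis
    using chi_cong[OF primitive_cube_root_square(1)[OF w]] chi_square[of "2 * w + 1"]
      primitive_cube_root_square(2)[OF w] by simp
qed

text \<open>The roots are \<open>x\<close>, \<open>w x\<close> and \<open>w^2 x\<close> for a
  primitive cube root of unity \<open>w\<close>; they differ since \<open>w\<close>,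
  \<open>w - 1\<close> and \<open>w + 1\<close> are units.\<close>

lemma card_cube_roots:
  assumes "\<not> int p dvd x"
  shows "card {y \<in> {0..<int p}. [y ^ 3 = x ^ 3] (mod int p)} = 3"
proof -
  obtain w where w: "[w\<^sup>2 + w + 1 = 0] (mod int p)"
    by (rule primitive_cube_root)
  have w1: "\<not> int p dvd w - 1"
    by (rule primitive_cube_root_minus_1[OF w])
  have w0: "\<not> int p dvd w"
  proof
    assume "int p dvd w"
    then have "int p dvd w * (w + 1)" by simp
    then have "int p dvd (w\<^sup>2 + w + 1) - w * (w + 1)"
      using w by (intro dvd_diff) (auto simp: cong_0_iff)
    then show False
      using not_dvd_small[of 1] p_gt_3 by (simp add: algebra_simps power2_eq_square)
  qed
  have wm: "\<not> int p dvd w + 1"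
  proof
    assume "int p dvd w + 1"
    then have "int p dvd (w\<^sup>2 + w + 1) - (w + 1)"
      using w by (intro dvd_diff) (auto simp: cong_0_iff)
    then show False
      using w0 dvd_power_imp by simp
  qed
  have iff: "[y ^ 3 = x ^ 3] (mod int p) \<longleftrightarrow>
     [y = x] (mod int p) \<or> [y = w * x] (mod int p) \<or> [y = w\<^sup>2 * x] (mod int p)" for y
  proof -
    have "(y ^ 3 - x ^ 3) - (y - x) * (y - w * x) * (y - w\<^sup>2 * x)
      = (w\<^sup>2 + w + 1) * (x * y\<^sup>2 - w * x\<^sup>2 * y + (w - 1) * x ^ 3)"
      by (simp add: algebra_simps power2_eq_square power3_eq_cube)
    then have "[y ^ 3 - x ^ 3 = (y - x) * (y - w * x) * (y - w\<^sup>2 * x)] (mod int p)"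
      using w by (simp add: cong_iff_dvd_diff)
    then have "int p dvd y ^ 3 - x ^ 3 \<longleftrightarrow> int p dvd (y - x) * (y - w * x) * (y - w\<^sup>2 * x)"
      by (rule cong_dvd_iff)
    then show ?thesis
      by (simp add: dvd_mult_iff cong_iff_dvd_diff)
  qed
  have "{y \<in> {0..<int p}. [y ^ 3 = x ^ 3] (mod int p)} = {x mod int p, (w * x) mod int p, (w\<^sup>2 * x) mod int p}"
    using p_gt_3 unfolding iff by (auto simp: cong_def)
  moreover have "x mod int p \<noteq> (w * x) mod int p"
  proof -
    have "w * x - x = (w - 1) * x" by (simp add: algebra_simps)
    then have "\<not> int p dvd w * x - x" using w1 assms by (simp only: dvd_mult_iff) simp
    then show ?thesis by (metis mod_eq_dvd_iff)
  qed
  moreover have "x mod int p \<noteq> (w\<^sup>2 * x) mod int p"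
  proof -
    have "w\<^sup>2 * x - x = (w - 1) * (w + 1) * x" by (simp add: algebra_simps power2_eq_square)
    then have "\<not> int p dvd w\<^sup>2 * x - x" using w1 wm assms by (simp only: dvd_mult_iff) simp
    then show ?thesis by (metis mod_eq_dvd_iff)
  qed
  moreover have "(w * x) mod int p \<noteq> (w\<^sup>2 * x) mod int p"
  proof -
    have "w\<^sup>2 * x - w * x = w * (w - 1) * x" by (simp add: algebra_simps power2_eq_square)
    then have "\<not> int p dvd w\<^sup>2 * x - w * x" using w0 w1 assms by (simp only: dvd_mult_iff) simp
    then show ?thesis by (metis mod_eq_dvd_iff)
  qed
  ultimately show ?thesis by simp
qed

text \<open>Expanding the square and summing over \<open>c\<close> first leaves \<open>p\<close>
  times the number of pairs with \<open>x^3 = y^3\<close>, minus \<open>p^2\<close>. Each nonzero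
  \<open>x\<close> has three partners, 0 has one.\<close>

lemma sum_mordell_sum_square: "(\<Sum>c\<in>{0..<int p}. (mordell_sum c)\<^sup>2) = 12 * int r * int p"
proof -
  have R: "{0..<int p} = insert 0 {1..<int p}"
    using p_gt_3 by auto
  have count: "(\<Sum>y\<in>{0..<int p}. if [x ^ 3 = y ^ 3] (mod int p) then int p else 0) = (if x = 0 then int p else 3 * int p)"
    if x: "x \<in> {0..<int p}" for x
  proof -
    have "(\<Sum>y\<in>{0..<int p}. if [x ^ 3 = y ^ 3] (mod int p) then int p else 0)
      = int p * int (card {y \<in> {0..<int p}. [y ^ 3 = x ^ 3] (mod int p)})"
      by (simp add: sum.inter_filter[symmetric] cong_sym_eq)
    moreover have "card {y \<in> {0..<int p}. [y ^ 3 = x ^ 3] (mod int p)} = (if x = 0 then 1 else 3)"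
    proof (cases "x = 0")
      case True
      have "{y \<in> {0..<int p}. [y ^ 3 = 0] (mod int p)} = {0}"
        using p_gt_3 dvd_residue_iff by (auto simp: cong_power_0_iff)
      then show ?thesis using True by simp
    next
      case False
      then show ?thesis
        using card_cube_roots[of x] not_dvd_small[of x] x by simp
    qed
    ultimately show ?thesis by simp
  qed
  have "(\<Sum>c\<in>{0..<int p}. (mordell_sum c)\<^sup>2)
    = (\<Sum>c\<in>{0..<int p}. \<Sum>x\<in>{0..<int p}. \<Sum>y\<in>{0..<int p}. chi (x ^ 3 + c) * chi (y ^ 3 + c))"
    unfolding mordell_sum_def power2_eq_square sum_product ..
  also have "\<dots> = (\<Sum>x\<in>{0..<int p}. \<Sum>c\<in>{0..<int p}. \<Sum>y\<in>{0..<int p}. chi (x ^ 3 + c) * chi (y ^ 3 + c))"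
    by (rule sum.swap)
  also have "\<dots> = (\<Sum>x\<in>{0..<int p}. \<Sum>y\<in>{0..<int p}. \<Sum>c\<in>{0..<int p}. chi (x ^ 3 + c) * chi (y ^ 3 + c))"
    by (intro sum.cong refl sum.swap)
  also have "\<dots> = (\<Sum>x\<in>{0..<int p}. (if x = 0 then int p else 3 * int p) - int p)"
    unfolding sum_chi_mult by (intro sum.cong refl) (simp add: sum_subtractf count)
  also have "\<dots> = (\<Sum>x\<in>{1..<int p}. 2 * int p)"
    unfolding R by simp
  also have "\<dots> = 12 * int r * int p"
    using p_eq by simp
  finally show ?thesis .
qed

text \<open>With \<open>g\<close> a primitive root, the units fall into three classes modulo cubes,
  represented by \<open>c\<close>, \<open>c g\<close>, \<open>c g^2\<close>, each of size
  \<open>(p - 1) / 3 = 2 r\<close>.\<close>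

lemma sum_units_cube_invariant:
  fixes f :: "int \<Rightarrow> int"
  assumes f: "\<And>x y. [x = y] (mod int p) \<Longrightarrow> f x = f y"
    and cube: "\<And>c. f (c * g ^ 3) = f c" and "f 0 = 0"
    and g: "bij_betw (\<lambda>i. g ^ i mod int p) {..<p - 1} {1..<int p}"
    and c: "\<not> int p dvd c"
  shows "(\<Sum>x\<in>{0..<int p}. f x) = 2 * int r * (f c + f (c * g) + f (c * g\<^sup>2))"
proof -
  have R: "{0..<int p} = insert 0 {1..<int p}"
    using p_gt_3 by auto
  have "(\<Sum>x\<in>{0..<int p}. f x) = (\<Sum>x\<in>{0..<int p}. f (c * x))"
    by (rule sum_scale_residues[symmetric, OF f c])
  also have "\<dots> = (\<Sum>x\<in>{1..<int p}. f (c * x))"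
    unfolding R using \<open>f 0 = 0\<close> by simp
  also have "\<dots> = (\<Sum>i<p - 1. f (c * (g ^ i mod int p)))"
    by (rule sum.reindex_bij_betw[OF g, symmetric])
  also have "\<dots> = (\<Sum>i<3 * (2 * r). f (c * g ^ i))"
    unfolding half_p by (intro sum.cong f) (auto simp: cong_def mod_mult_right_eq)
  also have "\<dots> = int (2 * r) * (f (c * g ^ 0) + f (c * g ^ 1) + f (c * g ^ 2))"
    by (rule sum_mult_nat_periodic) (simp add: power_add cube flip: mult.assoc)
  finally show ?thesis by simp
qed

text \<open>Let \<open>A\<close>, \<open>B\<close>, \<open>C\<close> be the values of
  \<open>chi x * mordell_sum x\<close> on the three classes, with \<open>A = mordell_sum c\<close>.
  From \<open>A + B + C = 0\<close> and \<open>A^2 + B^2 + C^2 = 6 p\<close> follows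
  \<open>(B - C)^2 = 12 p - 3 A^2\<close>.\<close>

lemma twelve_p_minus_mordell_sum_square:
  assumes "chi c = 1"
  obtains d where "12 * int p - 3 * (mordell_sum c)\<^sup>2 = d\<^sup>2"
proof -
  obtain g where g: "\<not> int p dvd g" "bij_betw (\<lambda>i. g ^ i mod int p) {..<p - 1} {1..<int p}"
    by (rule primitive_root_int) blast
  have c: "\<not> int p dvd c"
    using assms chi_eq_0_iff[of c] by auto
  have chi_g: "chi g * chi g = 1"
    using g(1) by (simp add: chi_mult_self)
  define B C where "B = chi (c * g) * mordell_sum (c * g)" and "C = chi (c * g\<^sup>2) * mordell_sum (c * g\<^sup>2)"
  have 1: "(\<Sum>x\<in>{0..<int p}. chi x * mordell_sum x)
      = 2 * int r * (chi c * mordell_sum c + chi (c * g) * mordell_sum (c * g) + chi (c * g\<^sup>2) * mordell_sum (c * g\<^sup>2))"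
  proof (rule sum_units_cube_invariant[OF _ _ _ g(2) c])
    show "chi (x * g ^ 3) * mordell_sum (x * g ^ 3) = chi x * mordell_sum x" for x
      using chi_g by (simp add: mordell_sum_mult_cube[OF g(1)] chi_mult chi_cube)
  qed (simp_all add: mordell_sum_0 chi_cong mordell_sum_cong cong: if_cong)
  have 2: "(\<Sum>x\<in>{0..<int p}. (mordell_sum x)\<^sup>2) = 2 * int r * ((mordell_sum c)\<^sup>2 + (mordell_sum (c * g))\<^sup>2 + (mordell_sum (c * g\<^sup>2))\<^sup>2)"
  proof (rule sum_units_cube_invariant[OF _ _ _ g(2) c])
    show "(mordell_sum (x * g ^ 3))\<^sup>2 = (mordell_sum x)\<^sup>2" for x
      using chi_g by (simp add: mordell_sum_mult_cube[OF g(1)] power_mult_distrib power2_eq_square)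
  qed (simp_all add: mordell_sum_0 mordell_sum_cong cong: if_cong)
  have sum: "mordell_sum c + B + C = 0"
    using 1 half_p(3) assms unfolding sum_chi_mult_mordell_sum B_def C_def by simp
  have sq: "B\<^sup>2 = (mordell_sum (c * g))\<^sup>2" "C\<^sup>2 = (mordell_sum (c * g\<^sup>2))\<^sup>2"
    using g(1) c unfolding B_def C_def
    by (simp_all add: power_mult_distrib power2_eq_square[of "chi _"] chi_mult_self dvd_mult_iff power2_eq_square[of g])
  have "2 * int r * ((mordell_sum c)\<^sup>2 + B\<^sup>2 + C\<^sup>2) = 2 * int r * (6 * int p)"
    using 2 unfolding sum_mordell_sum_square sq by auto
  then have sum_sq: "(mordell_sum c)\<^sup>2 + B\<^sup>2 + C\<^sup>2 = 6 * int p"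
    using half_p(3) by simp
  have "12 * int p - 3 * (mordell_sum c)\<^sup>2 = (B - C)\<^sup>2"
  proof -
    have "B + C = - mordell_sum c" using sum by simp
    then have "(B + C)\<^sup>2 = (mordell_sum c)\<^sup>2" by simp
    then show ?thesis
      using sum_sq by (simp add: power2_eq_square algebra_simps)
  qed
  then show ?thesis by (rule that)
qed

end

subsection \<open>Representations by quadratic forms\<close>

text \<open>All orbits have size 1 or 3; the induction removes an orbit of size 3.\<close>

lemma card_order_3_map:
  assumes "finite A" and f: "\<And>x. x \<in> A \<Longrightarrow> f x \<in> A" "\<And>x. x \<in> A \<Longrightarrow> f (f (f x)) = x"
  shows "[card A = card {x \<in> A. f x = x}] (mod 3)"
  using assms
proof (induction A rule: finite_psubset_induct)
  case (psubset A)
  show ?case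
  proof (cases "\<forall>x\<in>A. f x = x")
    case True
    then have "{x \<in> A. f x = x} = A" by auto
    then show ?thesis by simp
  next
    case False
    then obtain x where x: "x \<in> A" "f x \<noteq> x" by auto
    define T where "T = {x, f x, f (f x)}"
    have ne: "f (f x) \<noteq> x" "f (f x) \<noteq> f x"
      using x psubset.prems by metis+
    have T: "T \<subseteq> A" "card T = 3" "\<And>y. y \<in> T \<Longrightarrow> f y \<noteq> y"
      using x ne psubset.prems unfolding T_def by auto
    have "f y \<in> A - T" if "y \<in> A - T" for y
    proof -
      have "f y \<notin> T"
        using that psubset.prems x unfolding T_def by auto (metis+)
      then show ?thesis using that psubset.prems by blast
    qed
    then have "[card (A - T) = card {x \<in> A - T. f x = x}] (mod 3)"
      using x psubset.prems by (intro psubset.IH) (auto simp: T_def)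
    moreover have "{x \<in> A - T. f x = x} = {x \<in> A. f x = x}"
      using T by auto
    moreover have "card A = card (A - T) + 3"
      using T psubset.hyps card_mono[of A T] by (simp add: card_Diff_subset finite_subset)
    ultimately show ?thesis
      by (simp add: cong_def)
  qed
qed

text \<open>\<open>P\<close> divides \<open>x t - x' y\<close> for \<open>t = y'\<close> or
  \<open>t = - y'\<close>. Multiplying the two representations gives \<open>D k^2 \<le> n^2\<close>
  for the quotient \<open>k\<close>, and \<open>n^2 < D\<close> forces \<open>k = 0\<close>. The
  bound covers \<open>n = 1, D = 3\<close> and \<open>n = 4, D = 27\<close>.\<close>

lemma norm_form_unique:
  fixes x y x' y' n D P :: int
  assumes "prime P" and n: "0 < n" "n\<^sup>2 < D"
    and rep: "n * P = x\<^sup>2 + D * y\<^sup>2" "n * P = x'\<^sup>2 + D * y'\<^sup>2"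
  shows "x\<^sup>2 = x'\<^sup>2"
proof -
  have *: "x\<^sup>2 = x'\<^sup>2" if dvd: "P dvd x * t - x' * y" and t: "t\<^sup>2 = y'\<^sup>2" for t
  proof -
    obtain k where k: "x * t - x' * y = P * k"
      using dvd by blast
    \<comment> \<open>Brahmagupta's identity for the form \<open>x^2 + D y^2\<close>.\<close>
    have "(n * P)\<^sup>2 = (x * x' + D * y * t)\<^sup>2 + D * (P * k)\<^sup>2"
    proof -
      have "(n * P)\<^sup>2 = (x\<^sup>2 + D * y\<^sup>2) * (x'\<^sup>2 + D * t\<^sup>2)"
        using rep t by (simp add: power2_eq_square)
      then show ?thesis
        unfolding k[symmetric] by (simp add: power2_eq_square algebra_simps)
    qed
    then have "D * k\<^sup>2 * P\<^sup>2 \<le> n\<^sup>2 * P\<^sup>2"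
      by (simp add: power_mult_distrib mult_ac)
    moreover have "P\<^sup>2 > 0"
      using prime_gt_0_int[OF \<open>prime P\<close>] by simp
    ultimately have "D * k\<^sup>2 \<le> n\<^sup>2"
      by simp
    have "k = 0"
    proof (rule ccontr)
      assume "k \<noteq> 0"
      then have "1 \<le> k\<^sup>2" by (simp add: int_one_le_iff_zero_less)
      then have "D * 1 \<le> D * k\<^sup>2"
        using n zero_le_power2[of n] by (intro mult_left_mono) linarith+
      then show False using \<open>D * k\<^sup>2 \<le> n\<^sup>2\<close> n by simp
    qed
    then have "x * t = x' * y" using k by simp
    then have "x\<^sup>2 * t\<^sup>2 = x'\<^sup>2 * y\<^sup>2"
      by (metis power_mult_distrib)
    then have "x\<^sup>2 * (D * y'\<^sup>2) = x'\<^sup>2 * (D * y\<^sup>2)"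
      unfolding t by simp
    then have "x\<^sup>2 * (n * P - x'\<^sup>2) = x'\<^sup>2 * (n * P - x\<^sup>2)"
      using rep by (metis add_diff_cancel_left')
    then have "n * P * (x\<^sup>2 - x'\<^sup>2) = 0"
      by (simp add: algebra_simps)
    then show ?thesis
      using \<open>prime P\<close> n by auto
  qed
  have "(x * y' - x' * y) * (x * (- y') - x' * y) = n * P * (y\<^sup>2 - y'\<^sup>2)"
  proof -
    have "(x * y' - x' * y) * (x * (- y') - x' * y) = x'\<^sup>2 * y\<^sup>2 - x\<^sup>2 * y'\<^sup>2"
      by (simp add: power2_eq_square algebra_simps)
    moreover have "x\<^sup>2 = n * P - D * y\<^sup>2" "x'\<^sup>2 = n * P - D * y'\<^sup>2"
      using rep by simp_all
    ultimately show ?thesis by (simp add: algebra_simps)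
  qed
  then have "P dvd (x * y' - x' * y) * (x * (- y') - x' * y)"
    by simp
  then show ?thesis
    using *[of y'] *[of "- y'"] prime_dvd_mult_iff[OF \<open>prime P\<close>] by auto
qed

section \<open>Point counts on \<open>y^2 = x^3 + b^2\<close>\<close>

context prime_1_mod_6
begin

text \<open>The values \<open>s = y - b\<close> at points of \<open>y^2 = x^3 + b^2\<close> with
  \<open>x \<noteq> 0\<close>, where \<open>x^3 = s (s + 2 b)\<close>.\<close>

definition shifted_cubes :: "int \<Rightarrow> int set" where
  "shifted_cubes b = {s \<in> {0..<int p}. \<not> int p dvd s * (s + 2 * b) \<and> (\<exists>x. [x ^ 3 = s * (s + 2 * b)] (mod int p))}"

lemma card_cube_root_eq:
  "card {x \<in> {0..<int p}. [x ^ 3 = a] (mod int p)}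
    = (if int p dvd a then 1 else if \<exists>x. [x ^ 3 = a] (mod int p) then 3 else 0)"
proof (cases "int p dvd a")
  case True
  then have "[x ^ 3 = a] (mod int p) \<longleftrightarrow> int p dvd x" for x
    using cong_power_0_iff[of 3 x] by (metis cong_0_iff cong_sym cong_trans zero_less_numeral)
  then have "{x \<in> {0..<int p}. [x ^ 3 = a] (mod int p)} = {0}"
    using dvd_residue_iff p_gt_3 by auto
  then show ?thesis using True by simp
next
  case False
  show ?thesis
  proof (cases "\<exists>x. [x ^ 3 = a] (mod int p)")
    case True
    then obtain x where x: "[x ^ 3 = a] (mod int p)" by blast
    then have "\<not> int p dvd x"
      using False cong_power_0_iff[of 3 x] by (metis cong_0_iff cong_sym cong_trans zero_less_numeral)
    moreover have "[y ^ 3 = a] (mod int p) \<longleftrightarrow> [y ^ 3 = x ^ 3] (mod int p)" for y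
      using x cong_sym cong_trans by blast
    ultimately show ?thesis
      using card_cube_roots[of x] True False by simp
  qed (use False in auto)
qed

text \<open>Both sides count the points of \<open>y\<^sup>2 = x\<^sup>3 + b\<^sup>2\<close>, fibred over \<open>x\<close> and over \<open>y = s + b\<close>.\<close>

lemma mordell_sum_square_eq:
  assumes "\<not> int p dvd b"
  shows "int p + mordell_sum (b\<^sup>2) = 2 + 3 * int (card (shifted_cubes b))"
proof -
  let ?N = "\<lambda>a. if int p dvd a then 1 else if \<exists>x. [x ^ 3 = a] (mod int p) then 3 else 0 :: int"
  have N_cong: "?N a = ?N a'" if "[a = a'] (mod int p)" for a a'
  proof -
    have "int p dvd a \<longleftrightarrow> int p dvd a'"
      using that by (rule cong_dvd_iff)
    moreover have "(\<exists>x. [x ^ 3 = a] (mod int p)) \<longleftrightarrow> (\<exists>x. [x ^ 3 = a'] (mod int p))"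
      using that cong_sym cong_trans by blast
    ultimately show ?thesis by simp
  qed
  have "int p + mordell_sum (b\<^sup>2) = (\<Sum>x\<in>{0..<int p}. int (card {y \<in> {0..<int p}. [y\<^sup>2 = x ^ 3 + b\<^sup>2] (mod int p)}))"
    unfolding card_square_roots by (simp add: mordell_sum_def sum.distrib)
  also have "\<dots> = (\<Sum>x\<in>{0..<int p}. \<Sum>y\<in>{0..<int p}. if [y\<^sup>2 = x ^ 3 + b\<^sup>2] (mod int p) then 1 else 0)"
    by (simp add: sum.inter_filter[symmetric])
  also have "\<dots> = (\<Sum>y\<in>{0..<int p}. \<Sum>x\<in>{0..<int p}. if [x ^ 3 = y\<^sup>2 - b\<^sup>2] (mod int p) then 1 else 0)"
    by (subst sum.swap) (simp add: cong_iff_dvd_diff dvd_diff_commute algebra_simps)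
  also have "\<dots> = (\<Sum>y\<in>{0..<int p}. int (card {x \<in> {0..<int p}. [x ^ 3 = y\<^sup>2 - b\<^sup>2] (mod int p)}))"
    by (simp add: sum.inter_filter[symmetric])
  also have "\<dots> = (\<Sum>y\<in>{0..<int p}. ?N (y\<^sup>2 - b\<^sup>2))"
    unfolding card_cube_root_eq by (intro sum.cong refl) simp
  also have "\<dots> = (\<Sum>s\<in>{0..<int p}. ?N ((s + b)\<^sup>2 - b\<^sup>2))"
    by (rule sum_shift_residues[symmetric]) (intro N_cong cong_diff cong_pow cong_refl)
  also have "\<dots> = (\<Sum>s\<in>{0..<int p}. ?N (s * (s + 2 * b)))"
  proof -
    have "(s + b)\<^sup>2 - b\<^sup>2 = s * (s + 2 * b)" for s
      by (simp add: power2_eq_square algebra_simps)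
    then show ?thesis by (simp only:)
  qed
  also have "\<dots> = (\<Sum>s\<in>{0..<int p}. (if int p dvd s * (s + 2 * b) then 1 else 0)
      + (if s \<in> shifted_cubes b then 3 else 0))"
    by (intro sum.cong refl) (auto simp: shifted_cubes_def)
  also have "\<dots> = int (card {s \<in> {0..<int p}. int p dvd s * (s + 2 * b)}) + 3 * int (card (shifted_cubes b))"
  proof -
    have "shifted_cubes b = {s \<in> {0..<int p}. s \<in> shifted_cubes b}"
      by (auto simp: shifted_cubes_def)
    then show ?thesis
      by (simp add: sum.distrib flip: sum.inter_filter)
  qed
  \<comment> \<open>These are the two values of \<open>s\<close> with \<open>x = 0\<close>, each
    carrying one point.\<close>
  also have "{s \<in> {0..<int p}. int p dvd s * (s + 2 * b)} = {0, (- 2 * b) mod int p}"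
  proof -
    have "int p dvd s + 2 * b \<longleftrightarrow> s = (- 2 * b) mod int p" if "s \<in> {0..<int p}" for s
      using that mod_eq_dvd_iff[of s "int p" "- 2 * b"] by simp
    then show ?thesis
      using p_gt_3 dvd_residue_iff by (auto simp: dvd_mult_iff)
  qed
  also have "card {0, (- 2 * b) mod int p} = 2"
    using assms not_dvd_2 by (simp add: dvd_eq_mod_eq_0[symmetric] dvd_mult_iff)
  finally show ?thesis by simp
qed

text \<open>Fixes the sign of \<open>u\<close>: the half of \<open>mordell_sum 1\<close> is
  \<open>- 1\<close> modulo 3.\<close>

lemma mordell_sum_1_cong_3: "[mordell_sum 1 = 1] (mod 3)"
proof -
  have "mordell_sum 1 - 1 = 3 * (int (card (shifted_cubes 1)) - 2 * int r)"
    using mordell_sum_square_eq[of 1] not_dvd_small[of 1] p_gt_3 p_eq by simp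
  then show ?thesis
    by (simp add: cong_iff_dvd_diff)
qed

text \<open>\<open>chi (x^3 + 1)\<close> is odd except at the three cube roots of
  \<open>- 1\<close>, so the sum has the parity of \<open>p - 3\<close>.\<close>

lemma even_mordell_sum_1: "even (mordell_sum 1)"
proof -
  have "even (\<Sum>x\<in>{0..<int p}. chi (x ^ 3 + 1) - (1 - (if [x ^ 3 = (- 1) ^ 3] (mod int p) then 1 else 0)))"
  proof (rule dvd_sum)
    fix x
    have "chi (x ^ 3 + 1) = 0 \<longleftrightarrow> [x ^ 3 = (- 1) ^ 3] (mod int p)"
      by (simp add: chi_eq_0_iff cong_iff_dvd_diff)
    then show "even (chi (x ^ 3 + 1) - (1 - (if [x ^ 3 = (- 1) ^ 3] (mod int p) then 1 else 0)))"
      using chi_range[of "x ^ 3 + 1"] by auto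
  qed
  moreover have "(\<Sum>x\<in>{0..<int p}. if [x ^ 3 = (- 1) ^ 3] (mod int p) then 1 else 0 :: int) = 3"
    using card_cube_roots[of "-1"] not_dvd_small[of 1] p_gt_3 by (simp add: flip: sum.inter_filter)
  ultimately have "even (mordell_sum 1 - (int p - 3))"
    by (simp add: sum_subtractf mordell_sum_def)
  then show ?thesis
    using odd_p by simp
qed

text \<open>The map \<open>s \<mapsto> - 1 / (s + 1)\<close> has order 3 and fixes exactly the two roots of
  \<open>s\<^sup>2 + s + 1\<close>.\<close>

lemma card_shifted_cubes_half:
  assumes b: "[2 * b = 1] (mod int p)"
  shows "[card (shifted_cubes b) = 2] (mod 3)"
proof -
  define U where "U = {s \<in> {0..<int p}. \<not> int p dvd s \<and> \<not> int p dvd s + 1 \<and> (\<exists>x. [x ^ 3 = s * (s + 1)] (mod int p))}"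
  have "[s * (s + 2 * b) = s * (s + 1)] (mod int p)" for s
    using b by (intro cong_mult cong_add cong_refl)
  then have "int p dvd s * (s + 2 * b) \<longleftrightarrow> int p dvd s * (s + 1)"
    "[x ^ 3 = s * (s + 2 * b)] (mod int p) \<longleftrightarrow> [x ^ 3 = s * (s + 1)] (mod int p)" for s x
    using cong_dvd_iff cong_sym cong_trans by blast+
  then have U: "shifted_cubes b = U"
    unfolding shifted_cubes_def U_def by (auto simp: dvd_mult_iff)
  \<comment> \<open>By Fermat, \<open>(s + 1) ^ (p - 2)\<close> is an inverse of
    \<open>s + 1\<close>.\<close>
  define f where "f s = (- ((s + 1) ^ (p - 2))) mod int p" for s
  have f: "f s \<in> {0..<int p}" "[f s * (s + 1) = - 1] (mod int p)" if "s \<in> U" for s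
  proof -
    show "f s \<in> {0..<int p}"
      using p_gt_3 by (simp add: f_def)
    have "Suc (p - 2) = p - 1" using p_gt_3 by simp
    then have "(s + 1) ^ (p - 2) * (s + 1) = (s + 1) ^ (p - 1)"
      by (metis power_Suc2)
    moreover have "[(s + 1) ^ (p - 1) = 1] (mod int p)"
      by (rule fermat_int) (use that U_def in simp)
    moreover have "[f s * (s + 1) = - ((s + 1) ^ (p - 2)) * (s + 1)] (mod int p)"
      unfolding f_def by (intro cong_mult cong_refl) simp
    ultimately show "[f s * (s + 1) = - 1] (mod int p)"
      by (metis cong_minus_minus_iff cong_trans mult_minus_left)
  qed
  have unique: "f s = t" if "s \<in> U" "t \<in> {0..<int p}" "[t * (s + 1) = - 1] (mod int p)" for s t
  proof -
    have "[(s + 1) * f s = (s + 1) * t] (mod int p)"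
      using f(2)[OF that(1)] that(3) by (metis cong_sym cong_trans mult.commute)
    then have "[f s = t] (mod int p)"
      by (rule cong_mult_cancel[rotated]) (use that U_def in simp)
    then show ?thesis
      using f(1) that cong_imp_eq by blast
  qed
  have f_Suc: "[(f s + 1) * (s + 1) = s] (mod int p)" if "s \<in> U" for s
    using cong_add[OF f(2)[OF that] cong_refl[of "s + 1"]] by (simp add: algebra_simps)
  have f_U: "f s \<in> U" if s: "s \<in> U" for s
  proof -
    have "\<not> int p dvd f s * (s + 1)"
      using cong_dvd_iff[OF f(2)[OF s]] not_dvd_small[of 1] p_gt_3 by simp
    moreover have "\<not> int p dvd (f s + 1) * (s + 1)"
      using cong_dvd_iff[OF f_Suc[OF s]] s by (simp add: U_def)
    moreover have "\<exists>x. [x ^ 3 = f s * (f s + 1)] (mod int p)"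
    proof -
      obtain x where x: "[x ^ 3 = s * (s + 1)] (mod int p)"
        using s U_def by blast
      \<comment> \<open>With \<open>t = f s\<close>, the relation \<open>t (s + 1) = - 1\<close>
        gives \<open>t (t + 1) = - s t^2 = s (s + 1) t^3\<close>, so \<open>x t\<close> is the
        required cube root.\<close>
      have "(x * f s) ^ 3 - f s * (f s + 1)
        = (x ^ 3 - s * (s + 1)) * f s ^ 3 + (f s * (s + 1) - (- 1)) * (s * (f s)\<^sup>2 - f s)"
        by (simp add: algebra_simps power2_eq_square power3_eq_cube)
      moreover have "int p dvd x ^ 3 - s * (s + 1)" "int p dvd f s * (s + 1) - (- 1)"
        using x f(2)[OF s] by (simp_all only: cong_iff_dvd_diff)
      ultimately have "[(x * f s) ^ 3 = f s * (f s + 1)] (mod int p)"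
        by (simp only: cong_iff_dvd_diff dvd_add dvd_mult2)
      then show ?thesis by blast
    qed
    ultimately show ?thesis
      using f(1)[OF s] unfolding U_def by (auto simp: dvd_mult_iff)
  qed
  have "[card U = card {s \<in> U. f s = s}] (mod 3)"
  proof (rule card_order_3_map[OF _ f_U])
    fix s assume s: "s \<in> U"
    let ?b = "f s" and ?c = "f (f s)"
    have "(s * (?c + 1) - (- 1)) = (?c * (?b + 1) - (- 1)) * (s + 1) - ?c * (?b * (s + 1) - (- 1))"
      by (simp add: algebra_simps)
    moreover have "int p dvd ?c * (?b + 1) - (- 1)" "int p dvd ?b * (s + 1) - (- 1)"
      using f(2)[OF s] f(2)[OF f_U[OF s]] by (simp_all add: cong_iff_dvd_diff)
    ultimately have "[s * (?c + 1) = - 1] (mod int p)"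
      by (simp only: cong_iff_dvd_diff dvd_diff dvd_mult dvd_mult2)
    then show "f (f (f s)) = s"
      by (intro unique f_U s) (use s U_def in auto)
  qed (auto simp: U_def intro: finite_subset[of _ "{0..<int p}"])
  moreover have "card {s \<in> U. f s = s} = 2"
  proof -
    obtain w where w: "[w\<^sup>2 + w + 1 = 0] (mod int p)"
      by (rule primitive_cube_root)
    \<comment> \<open>A solution of \<open>s (s + 1) = - 1\<close> lies in \<open>U\<close> because
      \<open>- 1\<close> is a cube.\<close>
    have fixed: "s \<in> U \<and> f s = s \<longleftrightarrow> [s * (s + 1) = - 1] (mod int p)" if s: "s \<in> {0..<int p}" for s
    proof
      assume *: "[s * (s + 1) = - 1] (mod int p)"
      then have "\<not> int p dvd s * (s + 1)"
        using cong_dvd_iff[OF *] not_dvd_small[of 1] p_gt_3 by simp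
      moreover have "\<exists>x. [x ^ 3 = s * (s + 1)] (mod int p)"
        using cong_sym[OF *] by (intro exI[of _ "- 1"]) simp
      ultimately have "s \<in> U"
        using s unfolding U_def by (auto simp: dvd_mult_iff)
      then show "s \<in> U \<and> f s = s"
        using unique[OF _ s *] by blast
    qed (use f(2)[of s] in auto)
    have roots: "[s * (s + 1) = - 1] (mod int p) \<longleftrightarrow> int p dvd s - w \<or> int p dvd s - (- 1 - w)" for s
    proof -
      have "s * (s + 1) - (- 1) = (s - w) * (s - (- 1 - w)) + (w\<^sup>2 + w + 1)"
        by (simp add: algebra_simps power2_eq_square)
      then show ?thesis
        using w dvd_add_left_iff[of "int p" "w\<^sup>2 + w + 1" "(s - w) * (s - (- 1 - w))"]
        by (simp only: cong_iff_dvd_diff diff_zero dvd_mult_iff)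
    qed
    have "{s \<in> U. f s = s} = {s \<in> {0..<int p}. int p dvd s - w \<or> int p dvd s - (- 1 - w)}"
      using fixed roots U_def by blast
    also have "\<dots> = {w mod int p, (- 1 - w) mod int p}"
      using p_gt_3 by (auto simp: mod_eq_dvd_iff[symmetric])
    finally show ?thesis
      using primitive_cube_root_square(2)[OF w] mod_eq_dvd_iff[of w "int p" "- 1 - w"]
      by (simp add: algebra_simps)
  qed
  ultimately show ?thesis
    unfolding U by simp
qed

text \<open>With \<open>b = 1 / 2\<close> modulo \<open>p\<close>, 16 is \<open>b^2 * 4^3\<close>.
  As the size of \<open>shifted_cubes b\<close> is \<open>3 m + 2\<close>, the point count is
  \<open>2 + 3 (3 m + 2) = 9 m + 8\<close>.\<close>

lemma mordell_sum_16_cong_9: "9 dvd mordell_sum 16 + int p + 1"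
proof -
  obtain b :: int where b: "2 * b = int p + 1"
    using odd_p by (metis dvd_def even_of_nat odd_one odd_even_add)
  then have half: "[2 * b = 1] (mod int p)"
    by (simp add: cong_iff_dvd_diff)
  have "\<not> int p dvd b"
    using cong_dvd_iff[OF half] not_dvd_small[of 1] p_gt_3 by auto
  have not_4: "\<not> int p dvd 4"
    using not_dvd_2 dvd_mult_iff[of 2 2] by simp
  have "[16 * (2 * b)\<^sup>2 = 16 * 1\<^sup>2] (mod int p)"
    by (intro cong_mult cong_refl cong_pow half)
  then have "[16 = b\<^sup>2 * 4 ^ 3] (mod int p)"
    by (simp add: power_mult_distrib cong_sym_eq mult.commute)
  then have "mordell_sum 16 = chi 4 * mordell_sum (b\<^sup>2)"
    using mordell_sum_cong mordell_sum_mult_cube[OF not_4] by metis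
  moreover have "chi 4 = 1"
    using chi_square[of 2] not_dvd_2 by simp
  ultimately have mordell_sum: "int p + mordell_sum 16 = 2 + 3 * int (card (shifted_cubes b))"
    using mordell_sum_square_eq[OF \<open>\<not> int p dvd b\<close>] by simp
  have "card (shifted_cubes b) mod 3 = 2"
    using card_shifted_cubes_half[OF half] by (simp add: cong_def)
  then obtain m where "card (shifted_cubes b) = 3 * m + 2"
    by (metis mult_div_mod_eq)
  then have "mordell_sum 16 + int p + 1 = 9 * (int m + 1)"
    using mordell_sum by simp
  then show ?thesis by simp
qed

text \<open>Here \<open>d^2 = 12 (p - u^2)\<close>, so 6 divides \<open>d\<close> and
  \<open>v = d / 6\<close>.\<close>

lemma p_eq_mordell_sum_1:
  obtains u v where "mordell_sum 1 = 2 * u" "int p = u\<^sup>2 + 3 * v\<^sup>2"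
proof -
  obtain u where u: "mordell_sum 1 = 2 * u"
    using even_mordell_sum_1 by blast
  have "chi 1 = 1"
    using chi_square[of 1] not_dvd_small[of 1] p_gt_3 by simp
  then obtain d where "12 * int p - 3 * (mordell_sum 1)\<^sup>2 = d\<^sup>2"
    by (rule twelve_p_minus_mordell_sum_square)
  then have d: "d\<^sup>2 = 12 * (int p - u\<^sup>2)"
    using u by (simp add: power_mult_distrib algebra_simps)
  have "2 dvd d\<^sup>2" "3 dvd d\<^sup>2"
    unfolding d by simp_all
  then have "2 dvd d" "3 dvd d"
    using prime_dvd_power[of "2 :: int" d 2] prime_dvd_power[of "3 :: int" d 2] by simp_all
  then have "6 dvd d" by presburger
  then obtain v where "d = 6 * v" by blast
  then have "int p = u\<^sup>2 + 3 * v\<^sup>2"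
    using d by (simp add: power_mult_distrib)
  then show ?thesis using that u by blast
qed

text \<open>Since \<open>mordell_sum 16\<close> is \<open>- p - 1\<close> modulo 9 and
  \<open>4 p - (p + 1)^2 = - 36 r^2\<close>, 9 divides \<open>4 p - (mordell_sum 16)^2\<close>.
  Hence 27 divides \<open>d^2\<close>, so 9 divides \<open>d\<close>, and
  \<open>M = d / 9\<close>.\<close>

lemma four_p_eq_mordell_sum_16:
  obtains M where "4 * int p = (mordell_sum 16)\<^sup>2 + 27 * M\<^sup>2"
proof -
  have "chi 16 = 1"
    using chi_square[of 4] not_dvd_2 dvd_mult_iff[of 2 2] by simp
  then obtain d where d: "12 * int p - 3 * (mordell_sum 16)\<^sup>2 = d\<^sup>2"
    by (rule twelve_p_minus_mordell_sum_square)
  obtain j where j: "mordell_sum 16 + int p + 1 = 9 * j"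
    using mordell_sum_16_cong_9 by blast
  then have mordell_sum: "mordell_sum 16 = 9 * j - (6 * int r + 2)"
    using p_eq by simp
  have "4 * int p - (mordell_sum 16)\<^sup>2 = 9 * (12 * int r * j + 4 * j - 9 * j\<^sup>2 - 4 * (int r)\<^sup>2)"
    unfolding mordell_sum using p_eq by (simp add: power2_eq_square algebra_simps)
  then have d27: "d\<^sup>2 = 27 * (12 * int r * j + 4 * j - 9 * j\<^sup>2 - 4 * (int r)\<^sup>2)"
    using d by simp
  then have "3 dvd d\<^sup>2" by simp
  then have "3 dvd d"
    using prime_dvd_power[of "3 :: int" d 2] by simp
  then obtain e where e: "d = 3 * e" by blast
  then have "e\<^sup>2 = 3 * (12 * int r * j + 4 * j - 9 * j\<^sup>2 - 4 * (int r)\<^sup>2)"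
    using d27 by (simp add: power_mult_distrib)
  then have "3 dvd e\<^sup>2"
    by (simp only: dvd_triv_left)
  then have "3 dvd e"
    using prime_dvd_power[of "3 :: int" e 2] by simp
  then obtain M where "e = 3 * M" by blast
  then have "4 * int p = (mordell_sum 16)\<^sup>2 + 27 * M\<^sup>2"
    using d e by (simp add: power_mult_distrib)
  then show ?thesis by (rule that)
qed

section \<open>The sums in terms of \<open>u\<close> and \<open>L\<close>\<close>

lemma cong_minus_mordell_sum: "[int (3 * r choose r) * c ^ r = - mordell_sum c] (mod int p)"
proof -
  have "[- mordell_sum c = - (- (int (3 * r choose r) * c ^ r))] (mod int p)"
    by (simp only: cong_minus_minus_iff cong_mordell_sum)
  then show ?thesis
    by (simp add: cong_sym_eq)
qed

lemma p_div_3: "p div 3 = 2 * r"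
  using p_eq by simp

text \<open>Uniqueness gives \<open>u = u'\<close> or \<open>u = - u'\<close>; as \<open>u\<close>
  is 1 and \<open>u'\<close> is \<open>- 1\<close> modulo 3, the second holds, so
  \<open>2 u = - mordell_sum 1\<close>.\<close>

lemma cong_G_sum_minus_27_u:
  assumes rep: "int p = u\<^sup>2 + 3 * v\<^sup>2" and u: "3 dvd u - 1"
  shows "[G_sum (- 27) = 2 * u] (mod int p)"
proof -
  obtain u' v' where mordell_sum: "mordell_sum 1 = 2 * u'" and rep': "int p = u'\<^sup>2 + 3 * v'\<^sup>2"
    by (rule p_eq_mordell_sum_1)
  have "u\<^sup>2 = u'\<^sup>2"
    using norm_form_unique[OF prime_int_p, of 1 3 u v u' v'] rep rep' by simp
  then have "u = u' \<or> u = - u'"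
    by (simp add: power2_eq_iff)
  moreover have "3 dvd 2 * u' - 1"
    using mordell_sum_1_cong_3 mordell_sum by (simp add: cong_iff_dvd_diff)
  then have "u \<noteq> u'"
    using u by presburger
  ultimately have "2 * u = - mordell_sum 1"
    using mordell_sum by simp
  moreover have "[int (3 * r choose r) = - mordell_sum 1] (mod int p)"
    using cong_minus_mordell_sum[of 1] by simp
  ultimately show ?thesis
    using cong_G_sum_minus_27 unfolding p_div_3 half_p by (auto intro: cong_trans)
qed

text \<open>Uniqueness determines \<open>L\<close> up to sign, and \<open>mordell_sum 16\<close> is
  1 modulo 3, so \<open>L = mordell_sum 16\<close>.\<close>

lemma cong_G_sum_243_L:
  assumes rep: "4 * int p = L\<^sup>2 + 27 * M\<^sup>2" and L: "3 dvd L - 1"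
  shows "[G_sum 243 = - L] (mod int p)"
proof -
  obtain M' where rep': "4 * int p = (mordell_sum 16)\<^sup>2 + 27 * M'\<^sup>2"
    by (rule four_p_eq_mordell_sum_16)
  have "L\<^sup>2 = (mordell_sum 16)\<^sup>2"
    using norm_form_unique[OF prime_int_p, of 4 27 L M "mordell_sum 16" M'] rep rep' by simp
  then have "L = mordell_sum 16 \<or> L = - mordell_sum 16"
    by (simp add: power2_eq_iff)
  moreover have "int p = 6 * int r + 1"
    using p_eq by simp
  then have "3 dvd mordell_sum 16 - 1"
    using mordell_sum_16_cong_9 by presburger
  then have "L \<noteq> - mordell_sum 16"
    using L by presburger
  ultimately have L_eq: "L = mordell_sum 16" by simp
  have "(\<Sum>i\<le>3 * r. if 3 * i = 6 * r then int (3 * r choose i) * (- 2) ^ (3 * r - i) else 0)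
      = (\<Sum>i\<le>3 * r. if i = 2 * r then int (3 * r choose i) * (- 2) ^ (3 * r - i) else 0)"
    by (intro sum.cong refl) auto
  also have "\<dots> = int (3 * r choose r) * (- 2) ^ r"
    using binomial_symmetric[of r "3 * r"] by simp
  finally have G3: "[G_sum 3 = 24 ^ (3 * r) * (int (3 * r choose r) * (- 2) ^ r)] (mod int p)"
    using cong_G_sum_3[of "3 * r"] unfolding half_p by simp
  \<comment> \<open>From \<open>24^3 * (- 2) = 16 * (- 3)^3 * 2^6\<close>. The last two factors give
    1 modulo \<open>p\<close>, by \<open>chi (- 3) = 1\<close> and by Fermat.\<close>
  have base: "24 ^ (3 * r) * (- 2) ^ r = 16 ^ r * ((- 3) ^ (3 * r) * (2 :: int) ^ (6 * r))"
    unfolding power_mult by (simp flip: power_mult_distrib)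
  have 1: "24 ^ (3 * r) * (int (3 * r choose r) * (- 2) ^ r)
      = int (3 * r choose r) * 16 ^ r * ((- 3) ^ (3 * r) * 2 ^ (6 * r))"
    using arg_cong[OF base, of "(*) (int (3 * r choose r))"] by (simp only: mult_ac)
  have "[(- 3) ^ (3 * r) = 1] (mod int p)"
    using cong_chi[of "-3"] chi_minus_3 half_p by (simp add: cong_sym_eq)
  moreover have "[2 ^ (6 * r) = 1] (mod int p)"
    using fermat_int[OF not_dvd_2] half_p by simp
  ultimately have "[int (3 * r choose r) * 16 ^ r * ((- 3) ^ (3 * r) * 2 ^ (6 * r))
      = int (3 * r choose r) * 16 ^ r * (1 * 1)] (mod int p)"
    by (intro cong_mult cong_refl)
  then have "[G_sum 3 = int (3 * r choose r) * 16 ^ r] (mod int p)"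
    using cong_trans[OF G3[unfolded 1]] by simp
  moreover have "[int (3 * r choose r) * 16 ^ r = - L] (mod int p)"
    unfolding L_eq by (rule cong_minus_mordell_sum)
  moreover have "p - 1 - p div 3 = 2 * (2 * r)"
    using half_p p_div_3 by simp
  then have "[G_sum 243 = G_sum 3] (mod int p)"
    using cong_G_sum_243_eq by simp
  ultimately show ?thesis
    by (blast intro: cong_trans)
qed

end

section \<open>Assembly of the residue classes 1 and 5 modulo 6\<close>

theorem theorem3p8:
  fixes p :: nat
  assumes "prime p" and "p > 3"
  shows "(\<forall>u v :: int. int p = u\<^sup>2 + 3 * v\<^sup>2 \<and> [p = 1] (mod 3) \<and> 3 dvd u - 1 \<longrightarrow>
            rat_cong p (\<Sum>n = 0..p - 1. of_int (G3 n) / (- 27) ^ n) (of_int (2 * u))) \<and>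
         ([p = 2] (mod 3) \<longrightarrow>
            rat_cong p (\<Sum>n = 0..p - 1. of_int (G3 n) / (- 27) ^ n) 0) \<and>
         rat_cong p (\<Sum>n = 0..p - 1. of_int (G3 n) / 3 ^ n)
                    (\<Sum>n = 0..p - 1. of_int (G3 n) / 243 ^ n) \<and>
         (\<forall>L M :: int. 3 dvd int p - 1 \<and> 4 * int p = L\<^sup>2 + 27 * M\<^sup>2 \<and> 3 dvd L - 1 \<longrightarrow>
            rat_cong p (\<Sum>n = 0..p - 1. of_int (G3 n) / 243 ^ n) (of_int (- L))) \<and>
         ([p = 2] (mod 3) \<longrightarrow>
            rat_cong p (\<Sum>n = 0..p - 1. of_int (G3 n) / 243 ^ n) 0)"
proof -
  interpret prime_gt_3 p
    using assms by unfold_locales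
  have not_dvd_3: "\<not> int p dvd 3"
    using not_dvd_small[of 3] p_gt_3 by simp
  have not_dvd: "\<not> int p dvd - 27" "\<not> int p dvd 243"
    using not_dvd_3 dvd_power_imp[of 3 3] dvd_power_imp[of 3 5] by auto
  note rat_cong_minus_27 = rat_cong_G_sum[OF not_dvd(1), simplified]
    and rat_cong_3 = rat_cong_G_sum[OF not_dvd_3, simplified]
    and rat_cong_243 = rat_cong_G_sum[OF not_dvd(2), simplified]
  have "\<not> 3 dvd p"
    using primes_dvd_imp_eq[of 3 p] prime_p p_gt_3 by auto
  then have "p = 6 * (p div 6) + 1 \<or> p = 6 * (p div 6) + 5"
    using odd_p by presburger
  then consider (1) r where "p = 6 * r + 1" | (2) r where "p = 6 * r + 5"
    by blast
  then show ?thesis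
  proof cases
    case 1
    then interpret prime_1_mod_6 p r
      by unfold_locales
    have "even (p - 1 - p div 3)"
      unfolding half_p p_div_3 by simp
    then have "[G_sum 3 = G_sum 243] (mod int p)"
      using cong_G_sum_243_eq by (simp add: cong_sym_eq)
    moreover have "\<not> [p = 2] (mod 3)"
      using 1 by (simp add: cong_def) presburger
    ultimately show ?thesis
      using rat_cong_common[OF rat_cong_3 rat_cong_243[OF cong_refl]]
        rat_cong_minus_27[OF cong_G_sum_minus_27_u] rat_cong_243[OF cong_G_sum_243_L] by simp
  next
    case 2
    \<comment> \<open>An odd \<open>p div 3\<close> kills the middle coefficient of
      \<open>(1 - x^2) ^ (p div 3)\<close>.\<close>
    have "p div 3 = 2 * r + 1"
      using 2 by simp
    then have "[G_sum (- 27) = 0] (mod int p)"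
      using cong_G_sum_minus_27 by simp
    moreover have "[G_sum 3 = 0] (mod int p)"
      by (rule cong_G_sum_3_2_mod_3) (use 2 in presburger)
    moreover from this have "[(- 1) ^ (p - 1 - p div 3) * G_sum 3 = 0] (mod int p)"
      by (simp add: cong_0_iff)
    then have "[G_sum 243 = 0] (mod int p)"
      by (rule cong_trans[OF cong_G_sum_243_eq])
    moreover have "\<not> [p = 1] (mod 3)" "\<not> 3 dvd int p - 1"
      using 2 by (simp add: cong_def, presburger)+
    ultimately show ?thesis
      using rat_cong_common[OF rat_cong_3 rat_cong_243] rat_cong_minus_27[of 0] rat_cong_243[of 0] by simp
  qed
qed

end
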